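(* Let $\tau\in(2,3)$ and let $H$ be a fixed finite simple graph (motif) with $k$ vertices such that the maximum $$B_f(H)=\max_{\mathcal P}\left[|S_1|-|S_2|-\frac{2E_{S_1}+E_{S_1,S_3}}{\tau-1}\right]$$ over all partitions $\mathcal P=(S_1,S_2,S_3)$ of the vertex set of $H$ is attained by a unique partition. Then, as $n\to\infty$, the expected number of occurrences of $H$ in the hidden-variable model on $n$ vertices with exponent $\tau$ satisfies $$\mathbb E[N(H)]=\Theta\left(n^{\frac{3-\tau}{2}k+\frac{\tau-1}{2}B_f(H)}\right).$$
   Context: Hidden-variable model. Fix $\tau\in(2,3)$ and a constant $h_{\min}>0$. Each of the $n$ vertices independently receives a hidden variable drawn from the probability density $\rho(h)=Ch^{-\tau}$ on $h\ge h_{\min}$ ($C$ is the normalizing constant), and $\mu$ denotes the (finite) mean of this distribution. Conditionally on all hidden variables, each pair of distinct vertices with hidden variables $h,h'$ is joined by an edge independently with probability $p(h,h')=\min(hh'/(\mu n),1)$. Motif counts. $N(H)$ is the number of occurrences of $H$ as a not necessarily induced subgraph, i.e. the number of ordered $k$-tuples of distinct vertices $(v_1,\dots,v_k)$ such that $v_iv_j$ is an edge of the random graph whenever $\{i,j\}$ is an edge of $H$ (the number of unlabeled copies differs from this only by a constant factor depending on $H$). Partitions. In a partition $(S_1,S_2,S_3)$ of the vertices of $H$ the parts are disjoint, cover all vertices and may be empty. $E_{S_1}$ is the number of edges of $H$ with both endpoints in $S_1$, and $E_{S_1,S_3}$ is the number of edges of $H$ with one endpoint in $S_1$ and the other in $S_3$.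 $f(n)=\Theta(g(n))$ means that there are constants $0<c<c'<\infty$, independent of $n$, with $c\,g(n)\le f(n)\le c'g(n)$ for all large $n$. *)

theory Defs
  imports "HOL-Probability.Probability" "HOL-Library.Landau_Symbols"
begin

section \<open>The hidden-variable model\<close>

text \<open>The exponent is \<open>\<tau>\<close>, and \<open>a\<close> is the minimal hidden variable. The normalizing
  constant and the mean are defined as the integrals they stand for; \<open>hv_const_eq\<close>,
  \<open>integrable_hv_dist\<close> and \<open>hv_mean_eq\<close> below show that neither integral is a junk value.\<close>

definition hv_const :: "real \<Rightarrow> real \<Rightarrow> real" where
  "hv_const \<tau> a = 1 / (LINT h:{a..}|lborel. h powr (- \<tau>))"

definition hv_density :: "real \<Rightarrow> real \<Rightarrow> real \<Rightarrow> real" where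
  "hv_density \<tau> a h = (if a \<le> h then hv_const \<tau> a * h powr (- \<tau>) else 0)"

definition hv_dist :: "real \<Rightarrow> real \<Rightarrow> real measure" where
  "hv_dist \<tau> a = density lborel (\<lambda>h. ennreal (hv_density \<tau> a h))"

definition hv_mean :: "real \<Rightarrow> real \<Rightarrow> real" where
  "hv_mean \<tau> a = (LINT h|hv_dist \<tau> a. h)"

definition edge_prob :: "real \<Rightarrow> nat \<Rightarrow> real \<Rightarrow> real \<Rightarrow> real" where
  "edge_prob \<mu> n h h' = min (h * h' / (\<mu> * real n)) 1"

text \<open>The vertices are \<open>0, \<dots>, n - 1\<close> and a graph is identified with its set of edges,
  each edge being a two-element set. Given the hidden variables \<open>h\<close>, there is one independent
  coin for each unordered pair of distinct vertices, represented by its increasing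
  ordering.\<close>

definition hv_graph_given :: "real \<Rightarrow> nat \<Rightarrow> (nat \<Rightarrow> real) \<Rightarrow> nat set set pmf" where
  "hv_graph_given \<mu> n h =
     map_pmf (\<lambda>b. {{u, v} | u v. u < v \<and> v < n \<and> b (u, v)})
       (Pi_pmf {(u, v). u < v \<and> v < n} False (\<lambda>(u, v). bernoulli_pmf (edge_prob \<mu> n (h u) (h v))))"

text \<open>The law of the random graph on \<open>n\<close> vertices. All sets of graphs are measurable;
  \<open>measurable_hv_graph_given\<close> and \<open>prob_space_hv_graph\<close> below show that
  the composition is well defined.\<close>

definition hv_graph :: "real \<Rightarrow> real \<Rightarrow> nat \<Rightarrow> nat set set measure" where
  "hv_graph \<tau> a n =
     (\<Pi>\<^sub>M v\<in>{..<n}. hv_dist \<tau> a) \<bind> (\<lambda>h. measure_pmf (hv_graph_given (hv_mean \<tau> a) n h))"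


section \<open>Motif counts\<close>

definition simple_graph :: "'a set \<Rightarrow> 'a set set \<Rightarrow> bool" where
  "simple_graph V E \<longleftrightarrow> finite V \<and> (\<forall>e\<in>E. e \<subseteq> V \<and> card e = 2)"

text \<open>A tuple of distinct vertices, indexed by the vertices of the motif \<open>(V, E)\<close>, is an
  injective function on \<open>V\<close>; the extensional function space makes each tuple count once.\<close>

definition motif_count :: "'a set \<Rightarrow> 'a set set \<Rightarrow> nat \<Rightarrow> nat set set \<Rightarrow> nat" where
  "motif_count V E n G =
     card {\<phi> \<in> V \<rightarrow>\<^sub>E {..<n}. inj_on \<phi> V \<and> (\<forall>i\<in>V. \<forall>j\<in>V. {i, j} \<in> E \<longrightarrow> {\<phi> i, \<phi> j} \<in> G)}"

definition expected_motif_count :: "real \<Rightarrow> real \<Rightarrow> 'a set \<Rightarrow> 'a set set \<Rightarrow> nat \<Rightarrow> real" where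
  "expected_motif_count \<tau> a V E n = (LINT G|hv_graph \<tau> a n. real (motif_count V E n G))"


section \<open>The optimization problem\<close>

definition partitions3 :: "'a set \<Rightarrow> ('a set \<times> 'a set \<times> 'a set) set" where
  "partitions3 V = {(S\<^sub>1, S\<^sub>2, S\<^sub>3). S\<^sub>1 \<union> S\<^sub>2 \<union> S\<^sub>3 = V \<and> S\<^sub>1 \<inter> S\<^sub>2 = {} \<and> S\<^sub>1 \<inter> S\<^sub>3 = {} \<and> S\<^sub>2 \<inter> S\<^sub>3 = {}}"

definition edges_within :: "'a set set \<Rightarrow> 'a set \<Rightarrow> nat" where
  "edges_within E S = card {e \<in> E. e \<subseteq> S}"

definition edges_between :: "'a set set \<Rightarrow> 'a set \<Rightarrow> 'a set \<Rightarrow> nat" where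
  "edges_between E S T = card {e \<in> E. \<exists>u\<in>S. \<exists>v\<in>T. e = {u, v}}"

definition partition_value :: "real \<Rightarrow> 'a set set \<Rightarrow> 'a set \<times> 'a set \<times> 'a set \<Rightarrow> real" where
  "partition_value \<tau> E = (\<lambda>(S\<^sub>1, S\<^sub>2, S\<^sub>3).
     real (card S\<^sub>1) - real (card S\<^sub>2)
       - (2 * real (edges_within E S\<^sub>1) + real (edges_between E S\<^sub>1 S\<^sub>3)) / (\<tau> - 1))"

definition B\<^sub>f :: "real \<Rightarrow> 'a set \<Rightarrow> 'a set set \<Rightarrow> real" where
  "B\<^sub>f \<tau> V E = Max (partition_value \<tau> E ` partitions3 V)"


section \<open>Well-definedness\<close>

lemma has_bochner_integral_powr_atLeast:
  fixes a s :: real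
  assumes "a > 0" "s < -1"
  shows "has_bochner_integral lborel (\<lambda>h. indicator {a..} h *\<^sub>R h powr s) (- (a powr (s + 1)) / (s + 1))"
proof (rule has_bochner_integral_nn_integral)
  have lim: "((\<lambda>h. h powr (s + 1) / (s + 1)) \<longlongrightarrow> 0 / (s + 1)) at_top"
    using assms by (intro tendsto_intros tendsto_neg_powr filterlim_ident) auto
  have "(\<integral>\<^sup>+ h. ennreal (h powr s) * indicator {a..} h \<partial>lborel)
      = ennreal (0 / (s + 1) - a powr (s + 1) / (s + 1))"
  proof (rule nn_integral_FTC_atLeast)
    show "((\<lambda>h. h powr (s + 1) / (s + 1)) has_real_derivative h powr s) (at h)" if "a \<le> h" for h
    proof -
      have "((\<lambda>h. h powr (s + 1)) has_real_derivative (s + 1) * h powr (s + 1 - 1)) (at h)"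
        using that assms by (intro has_real_derivative_powr) auto
      from DERIV_cdivide[OF this, of "s + 1"] show ?thesis
        using assms by simp
    qed
  qed (use lim in auto)
  also have "(\<integral>\<^sup>+ h. ennreal (h powr s) * indicator {a..} h \<partial>lborel)
      = (\<integral>\<^sup>+ h. ennreal (indicator {a..} h *\<^sub>R h powr s) \<partial>lborel)"
    by (intro nn_integral_cong) (auto split: split_indicator)
  finally show "(\<integral>\<^sup>+ h. ennreal (indicator {a..} h *\<^sub>R h powr s) \<partial>lborel)
      = ennreal (- (a powr (s + 1)) / (s + 1))"
    by simp
  show "0 \<le> - (a powr (s + 1)) / (s + 1)"
    using assms by (auto simp: divide_simps)
qed auto

lemma hv_const_eq:
  assumes "a > 0" "\<tau> > 1"
  shows "hv_const \<tau> a = (\<tau> - 1) * a powr (\<tau> - 1)"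
proof -
  have "(LINT h:{a..}|lborel. h powr (- \<tau>)) = - (a powr (- \<tau> + 1)) / (- \<tau> + 1)"
    unfolding set_lebesgue_integral_def
    using has_bochner_integral_powr_atLeast[of a "- \<tau>"] assms
    by (intro has_bochner_integral_integral_eq) auto
  also have "\<dots> = a powr (- (\<tau> - 1)) / (\<tau> - 1)"
    using assms by (simp add: divide_simps) (simp add: algebra_simps)
  also have "\<dots> = 1 / ((\<tau> - 1) * a powr (\<tau> - 1))"
    by (simp only: powr_minus) (simp add: divide_simps)
  finally show ?thesis
    by (simp add: hv_const_def)
qed

lemma hv_density_eq:
  "hv_density \<tau> a h = hv_const \<tau> a * (indicator {a..} h *\<^sub>R h powr (- \<tau>))"
  by (auto simp: hv_density_def split: split_indicator)

lemma hv_density_measurable [measurable]: "hv_density \<tau> a \<in> borel_measurable borel"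
  unfolding hv_density_def by measurable

lemma hv_density_nonneg:
  assumes "a > 0" "\<tau> > 1"
  shows "hv_density \<tau> a h \<ge> 0"
  using assms by (auto simp: hv_density_def hv_const_eq)

lemma sets_hv_dist [measurable_cong]: "sets (hv_dist \<tau> a) = sets borel"
  by (simp add: hv_dist_def)

lemma prob_space_hv_dist:
  assumes "a > 0" "\<tau> > 1"
  shows "prob_space (hv_dist \<tau> a)"
proof
  have "has_bochner_integral lborel (hv_density \<tau> a)
      (hv_const \<tau> a * (- (a powr (- \<tau> + 1)) / (- \<tau> + 1)))"
    unfolding hv_density_eq[abs_def] using assms
    by (intro has_bochner_integral_mult_right has_bochner_integral_powr_atLeast) auto
  moreover have "hv_const \<tau> a * (- (a powr (- \<tau> + 1)) / (- \<tau> + 1)) = 1"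
    using assms powr_add[of a "\<tau> - 1" "- \<tau> + 1"] by (simp add: hv_const_eq field_simps)
  ultimately have "has_bochner_integral lborel (hv_density \<tau> a) 1" by simp
  then have "(\<integral>\<^sup>+ h. ennreal (hv_density \<tau> a h) \<partial>lborel) = 1"
    using hv_density_nonneg[OF assms]
    by (subst nn_integral_eq_integral) (auto simp: has_bochner_integral_iff)
  then show "emeasure (hv_dist \<tau> a) (space (hv_dist \<tau> a)) = 1"
    by (simp add: hv_dist_def emeasure_density)
qed

lemma has_bochner_integral_hv_dist:
  assumes "a > 0" "\<tau> > 2"
  shows "has_bochner_integral (hv_dist \<tau> a) (\<lambda>h. h) ((\<tau> - 1) / (\<tau> - 2) * a)"
proof -
  have "has_bochner_integral lborel
      (\<lambda>h. hv_const \<tau> a * (indicator {a..} h *\<^sub>R h powr (- \<tau> + 1)))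
      (hv_const \<tau> a * (- (a powr (- \<tau> + 1 + 1)) / (- \<tau> + 1 + 1)))"
    using assms by (intro has_bochner_integral_mult_right has_bochner_integral_powr_atLeast) auto
  moreover have "hv_const \<tau> a * (indicator {a..} h *\<^sub>R h powr (- \<tau> + 1)) = hv_density \<tau> a h *\<^sub>R h" for h
    using assms powr_add[of h "- \<tau>" 1] by (auto simp: hv_density_def split: split_indicator)
  moreover have "hv_const \<tau> a * (- (a powr (- \<tau> + 1 + 1)) / (- \<tau> + 1 + 1)) = (\<tau> - 1) / (\<tau> - 2) * a"
  proof -
    have "a powr (\<tau> - 1) * a powr (- \<tau> + 1 + 1) = a"
      using assms by (simp flip: powr_add)
    then show ?thesis
      using assms by (simp add: hv_const_eq field_simps)
  qed
  ultimately have "has_bochner_integral lborel (\<lambda>h. hv_density \<tau> a h *\<^sub>R h) ((\<tau> - 1) / (\<tau> - 2) * a)"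
    by simp
  then show ?thesis
    unfolding hv_dist_def using assms hv_density_nonneg[of a \<tau>]
    by (intro has_bochner_integral_density) auto
qed

lemma integrable_hv_dist: "a > 0 \<Longrightarrow> \<tau> > 2 \<Longrightarrow> integrable (hv_dist \<tau> a) (\<lambda>h. h)"
  using has_bochner_integral_hv_dist by (auto simp: has_bochner_integral_iff)

lemma hv_mean_eq: "a > 0 \<Longrightarrow> \<tau> > 2 \<Longrightarrow> hv_mean \<tau> a = (\<tau> - 1) / (\<tau> - 2) * a"
  using has_bochner_integral_hv_dist[of a \<tau>] by (auto simp: has_bochner_integral_iff hv_mean_def)

lemma finite_pairs: "finite {(u, v). u < v \<and> v < (n :: nat)}"
  by (rule finite_subset[of _ "{..<n} \<times> {..<n}"]) auto

lemma measurable_hv_graph_given: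
  "(\<lambda>h. measure_pmf (hv_graph_given \<mu> n h))
     \<in> measurable (\<Pi>\<^sub>M v\<in>{..<n}. hv_dist \<tau> a) (subprob_algebra (count_space UNIV))"
proof (rule measurable_subprob_algebra)
  let ?P = "{(u, v). u < v \<and> v < n}"
  let ?F = "PiE_dflt ?P False (\<lambda>_. UNIV)"
  let ?p = "\<lambda>h (u, v). bernoulli_pmf (edge_prob \<mu> n (h u) (h v))"
  fix A :: "nat set set set"
  define A' where "A' = (\<lambda>b. {{u, v} | u v. u < v \<and> v < n \<and> b (u, v)}) -` A"
  have fin: "finite ?F"
    using finite_pairs by (intro finite_PiE_dflt) auto
  have "emeasure (measure_pmf (hv_graph_given \<mu> n h)) A
      = (\<Sum>b\<in>A' \<inter> ?F. ennreal (\<Prod>x\<in>?P. pmf (?p h x) (b x)))" for h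
  proof -
    have "emeasure (measure_pmf (hv_graph_given \<mu> n h)) A = emeasure (Pi_pmf ?P False (?p h)) A'"
      unfolding hv_graph_given_def A'_def by simp
    also have "\<dots> = emeasure (Pi_pmf ?P False (?p h)) (A' \<inter> ?F)"
      using set_Pi_pmf_subset'[OF finite_pairs, of n False "?p h"]
      by (intro emeasure_eq_AE AE_pmfI) (auto simp: PiE_dflt_def)
    also have "\<dots> = (\<Sum>b\<in>A' \<inter> ?F. ennreal (pmf (Pi_pmf ?P False (?p h)) b))"
      using fin by (subst emeasure_measure_pmf_finite) auto
    also have "\<dots> = (\<Sum>b\<in>A' \<inter> ?F. ennreal (\<Prod>x\<in>?P. pmf (?p h x) (b x)))"
      using finite_pairs
      by (intro sum.cong refl, subst pmf_Pi) (auto simp: PiE_dflt_def)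
    finally show ?thesis .
  qed
  moreover have "(\<lambda>h. pmf (?p h x) c) \<in> borel_measurable (\<Pi>\<^sub>M v\<in>{..<n}. hv_dist \<tau> a)"
    if x_in: "x \<in> ?P" for x c
  proof -
    obtain u v where x: "x = (u, v)" "u \<in> {..<n}" "v \<in> {..<n}"
      using x_in by fastforce
    have 1: "pmf (bernoulli_pmf q) c = (if c then min 1 (max 0 q) else 1 - min 1 (max 0 q))" for q
      by (simp add: bernoulli_pmf.rep_eq flip: pmf.rep_eq)
    have [measurable]: "(\<lambda>h. h u) \<in> borel_measurable (\<Pi>\<^sub>M v\<in>{..<n}. hv_dist \<tau> a)"
         "(\<lambda>h. h v) \<in> borel_measurable (\<Pi>\<^sub>M v\<in>{..<n}. hv_dist \<tau> a)"
      using measurable_component_singleton[OF x(2), of "\<lambda>_. hv_dist \<tau> a"]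
            measurable_component_singleton[OF x(3), of "\<lambda>_. hv_dist \<tau> a"]
      by (simp_all cong: measurable_cong_sets add: sets_hv_dist)
    show ?thesis
      unfolding x(1) prod.case 1 edge_prob_def by measurable
  qed
  ultimately show "(\<lambda>h. emeasure (measure_pmf (hv_graph_given \<mu> n h)) A)
      \<in> borel_measurable (\<Pi>\<^sub>M v\<in>{..<n}. hv_dist \<tau> a)"
    by (simp only:) (intro borel_measurable_sum measurable_compose[OF _ measurable_ennreal]
        borel_measurable_prod)
qed (auto simp: measure_pmf.subprob_space_axioms)

lemma prob_space_hv_graph:
  assumes "a > 0" "\<tau> > 1"
  shows "prob_space (hv_graph \<tau> a n)"
proof -
  interpret prob_space "\<Pi>\<^sub>M v\<in>{..<n}. hv_dist \<tau> a"
    using prob_space_hv_dist[OF assms] by (rule prob_space_PiM)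
  show ?thesis
    unfolding hv_graph_def
    by (rule prob_space_bind[OF _ measurable_hv_graph_given]) (simp add: measure_pmf.prob_space_axioms)
qed

lemma sets_hv_graph:
  assumes "a > 0" "\<tau> > 1"
  shows "sets (hv_graph \<tau> a n) = UNIV"
proof -
  interpret prob_space "\<Pi>\<^sub>M v\<in>{..<n}. hv_dist \<tau> a"
    using prob_space_hv_dist[OF assms] by (rule prob_space_PiM)
  show ?thesis
    unfolding hv_graph_def using not_empty by (subst sets_bind) auto
qed

lemma finite_partitions3:
  assumes "finite V"
  shows "finite (partitions3 V)"
  by (rule finite_subset[of _ "Pow V \<times> Pow V \<times> Pow V"]) (use assms in \<open>auto simp: partitions3_def\<close>)

lemma partitions3_nonempty: "partitions3 V \<noteq> {}"
  by (auto simp: partitions3_def)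

end

theory Submission
  imports Defs
begin

text \<open>Write \<open>s = sqrt (\<mu> n)\<close>, \<open>R = s / a\<close> and \<open>h\<^sub>i = s R\<^bsup>u i\<^esup>\<close>, so that \<open>u i \<ge> -1\<close>. Up to constants, the
  expected number of copies is \<open>n\<^bsup>k\<^esup> s\<^bsup>(1 - \<tau>) k\<^esup>\<close> times the integral of \<open>R\<^bsup>F u\<^esup>\<close> against
  \<open>d(ln h\<^sub>i)\<close>, where \<open>F\<close> is piecewise linear. At the points of \<open>{-1, 0, 1}\<^bsup>V\<^esup>\<close>, which correspond to
  partitions, \<open>F\<close> equals \<open>(\<tau> - 1)\<close> times the partition value. Rounding all coordinates with a common
  uniform threshold writes \<open>F u\<close> on the cube \<open>[-1, 1]\<^bsup>V\<^esup>\<close> exactly as an average of values of \<open>F\<close> at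
  such points. Hence, if the optimal point \<open>r\<close> is unique, then
  \<open>F u \<le> F r - c \<Sum>\<^sub>i \<bar>u i - r i\<bar>\<close>, and the integral is dominated by a product of convergent
  one-dimensional integrals. The lower bound comes from the box \<open>s R\<^bsup>r i\<^esup> \<le> h\<^sub>i \<le> 2 s R\<^bsup>r i\<^esup>\<close>.\<close>

section \<open>The exponent and its unique maximum\<close>

text \<open>With \<open>x\<^sub>i = R\<^bsup>u i\<^esup>\<close>, this is the exponent of \<open>R\<close> in
  \<open>\<Prod>\<^sub>i x\<^sub>i\<^bsup>1 - \<tau>\<^esup> \<Prod>\<^sub>i\<^sub>j min (x\<^sub>i x\<^sub>j) 1\<close>; one factor \<open>x\<^sub>i\<close> per vertex comes from \<open>dx\<^sub>i = x\<^sub>i d(ln x\<^sub>i)\<close>.\<close>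

definition log_weight :: "real \<Rightarrow> 'a set \<Rightarrow> 'a set set \<Rightarrow> ('a \<Rightarrow> real) \<Rightarrow> real" where
  "log_weight \<tau> V E u = (1 - \<tau>) * (\<Sum>i\<in>V. u i) + (\<Sum>e\<in>E. min (\<Sum>i\<in>e. u i) 0)"

text \<open>The label -1, 1 or 0 records membership in the first, second or third part: it is the value
  of \<open>u\<close> on that part.\<close>

definition partition_of :: "'a set \<Rightarrow> ('a \<Rightarrow> real) \<Rightarrow> 'a set \<times> 'a set \<times> 'a set" where
  "partition_of V r = ({i\<in>V. r i = -1}, {i\<in>V. r i = 1}, {i\<in>V. r i = 0})"

definition label_of :: "'a set \<times> 'a set \<times> 'a set \<Rightarrow> 'a \<Rightarrow> real" where
  "label_of = (\<lambda>(S\<^sub>1, S\<^sub>2, S\<^sub>3) i. if i \<in> S\<^sub>1 then -1 else if i \<in> S\<^sub>2 then 1 else 0)"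

lemma partition_of_in_partitions3:
  assumes "\<And>i. i \<in> V \<Longrightarrow> r i \<in> {-1, 0, 1}"
  shows "partition_of V r \<in> partitions3 V"
  using assms by (force simp: partition_of_def partitions3_def)

lemma partition_of_label_of:
  assumes "P \<in> partitions3 V"
  shows "partition_of V (label_of P) = P"
  using assms by (auto simp: partition_of_def label_of_def partitions3_def split: if_splits)

lemma label_of_partition_of:
  assumes "i \<in> V" "r i \<in> {-1, 0, 1}"
  shows "label_of (partition_of V r) i = r i"
  using assms by (auto simp: partition_of_def label_of_def)

lemma simple_graph_finite_edges: "simple_graph V E \<Longrightarrow> finite E"
  by (rule finite_subset[of _ "Pow V"]) (auto simp: simple_graph_def)

lemma simple_graph_edgeE:
  assumes "simple_graph V E" "e \<in> E"
  obtains i j where "e = {i, j}" "i \<noteq> j" "i \<in> V" "j \<in> V"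
  using assms unfolding simple_graph_def card_2_iff by (metis insert_subset)

text \<open>An edge inside \<open>S1\<close> has label sum -2, an edge between \<open>S1\<close> and
  \<open>S3\<close> has sum -1, and every other edge has a nonnegative sum. The edge minima
  therefore reproduce the two edge counts, and the linear term gives \<open>(\<tau> - 1)\<close>
  times the difference of the part sizes.\<close>

lemma log_weight_partition:
  assumes G: "simple_graph V E" and "\<tau> > 1" and r: "\<And>i. i \<in> V \<Longrightarrow> r i \<in> {-1, 0, 1}"
  shows "log_weight \<tau> V E r = (\<tau> - 1) * partition_value \<tau> E (partition_of V r)"
proof -
  define S1 S2 S3 where "S1 = {i\<in>V. r i = -1}" and "S2 = {i\<in>V. r i = 1}" and "S3 = {i\<in>V. r i = 0}"
  have finV: "finite V" and finE: "finite E"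
    using G simple_graph_finite_edges by (auto simp: simple_graph_def)
  have "(\<Sum>i\<in>V. r i) = (\<Sum>i\<in>V. of_bool (i \<in> S2) - of_bool (i \<in> S1))"
    using r by (intro sum.cong refl) (force simp: S1_def S2_def)
  also have "\<dots> = real (card S2) - real (card S1)"
  proof -
    have "V \<inter> S1 = S1" "V \<inter> S2 = S2" by (auto simp: S1_def S2_def)
    then show ?thesis using finV by (simp add: sum_subtractf of_bool_def sum.If_cases)
  qed
  finally have 1: "(\<Sum>i\<in>V. r i) = real (card S2) - real (card S1)" .
  have "(\<Sum>e\<in>E. min (\<Sum>i\<in>e. r i) 0)
      = (\<Sum>e\<in>E. - 2 * of_bool (e \<subseteq> S1) - of_bool (\<exists>u\<in>S1. \<exists>v\<in>S3. e = {u, v}))"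
  proof (intro sum.cong refl)
    fix e assume "e \<in> E"
    with G obtain i j where e: "e = {i, j}" "i \<noteq> j" "i \<in> V" "j \<in> V" by (rule simple_graph_edgeE)
    have "(\<exists>u\<in>S1. \<exists>v\<in>S3. e = {u, v}) \<longleftrightarrow> (i \<in> S1 \<and> j \<in> S3) \<or> (j \<in> S1 \<and> i \<in> S3)"
      using e by (auto simp: doubleton_eq_iff)
    then show "min (\<Sum>i\<in>e. r i) 0 = - 2 * of_bool (e \<subseteq> S1) - of_bool (\<exists>u\<in>S1. \<exists>v\<in>S3. e = {u, v})"
      using r[of i] r[of j] e by (auto simp: S1_def S3_def)
  qed
  also have "\<dots> = - 2 * real (edges_within E S1) - real (edges_between E S1 S3)"
    using finE by (simp add: sum_subtractf of_bool_def sum.If_cases edges_within_def edges_between_def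
        sum_negf Collect_conj_eq flip: sum_distrib_left)
  finally have 2: "(\<Sum>e\<in>E. min (\<Sum>i\<in>e. r i) 0)
      = - 2 * real (edges_within E S1) - real (edges_between E S1 S3)" .
  show ?thesis
    unfolding log_weight_def 1 2 partition_of_def S1_def[symmetric] S2_def[symmetric] S3_def[symmetric]
    using \<open>\<tau> > 1\<close> by (simp add: partition_value_def right_diff_distrib) (simp add: algebra_simps)
qed

text \<open>For uniform \<open>\<theta>\<close> in \<open>[0, 1]\<close> this is a randomized rounding of \<open>x\<close> to \<open>{-1, 0, 1}\<close> with
  mean \<open>x\<close>. All coordinates share the same \<open>\<theta>\<close>, which is what makes the expectation commute
  with the nonlinear edge terms in \<open>has_integral_min_threshold\<close>.\<close>

definition threshold :: "real \<Rightarrow> real \<Rightarrow> real" where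
  "threshold \<theta> x = (if 0 \<le> x then of_bool (\<theta> \<le> x) else - of_bool (\<theta> \<le> - x))"

lemma has_integral_of_bool_le:
  fixes s :: real
  assumes "0 \<le> s" "s \<le> 1"
  shows "((\<lambda>\<theta>. of_bool (\<theta> \<le> s)) has_integral s) {0..1}"
proof -
  have "((\<lambda>\<theta>. if \<theta> \<in> {0..s} then 1 else 0) has_integral s) {0..1}"
    using has_integral_const_real[of "1::real" 0 s] assms by (subst has_integral_restrict) auto
  then show ?thesis
    by (rule has_integral_eq[rotated]) auto
qed

lemma has_integral_eqI:
  "(f has_integral j) S \<Longrightarrow> (\<And>x. x \<in> S \<Longrightarrow> g x = f x) \<Longrightarrow> i = j \<Longrightarrow> (g has_integral i) S"
  by (metis has_integral_eq)

lemma threshold_in: "threshold \<theta> x \<in> {-1, 0, 1}"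
  by (auto simp: threshold_def)

lemma has_integral_threshold:
  assumes "-1 \<le> x" "x \<le> 1"
  shows "((\<lambda>\<theta>. threshold \<theta> x) has_integral x) {0..1}"
proof (cases "0 \<le> x")
  case True
  then show ?thesis
    using has_integral_of_bool_le[of x] assms by (simp add: threshold_def[abs_def])
next
  case False
  then show ?thesis
    using has_integral_neg[OF has_integral_of_bool_le[of "- x"]] assms by (simp add: threshold_def[abs_def])
qed

text \<open>For \<open>r = 1\<close> and \<open>r = -1\<close> the distance to \<open>r\<close> is
  affine on [-1, 1], so it respects the mean of the rounding; for \<open>r = 0\<close> the rounded
  value is nonzero exactly when \<open>\<theta> \<le> \<bar>x\<bar>\<close>. The penalty in
  \<open>log_weight_decay\<close> can thus be averaged without loss.\<close>

lemma has_integral_abs_threshold_diff: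
  assumes "-1 \<le> x" "x \<le> 1" "r \<in> {-1, 0, 1}"
  shows "((\<lambda>\<theta>. \<bar>threshold \<theta> x - r\<bar>) has_integral \<bar>x - r\<bar>) {0..1}"
proof -
  have t: "((\<lambda>\<theta>. threshold \<theta> x) has_integral x) {0..1}"
    using assms by (intro has_integral_threshold)
  have one: "((\<lambda>\<theta>. 1) has_integral (1 :: real)) {0..1::real}"
    using has_integral_const_real[of "1::real" 0 1] by simp
  consider "r = 0" | "r = 1" | "r = -1" using assms by auto
  then show ?thesis
  proof cases
    case 1
    have "((\<lambda>\<theta>. of_bool (\<theta> \<le> \<bar>x\<bar>)) has_integral \<bar>x\<bar>) {0..1::real}"
      using assms by (intro has_integral_of_bool_le) auto
    then show ?thesis
      by (rule has_integral_eqI) (auto simp: 1 threshold_def)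
  next
    case 2
    then show ?thesis using assms
      by (intro has_integral_eqI[OF has_integral_diff[OF one t]])
         (auto simp: threshold_def)
  next
    case 3
    then show ?thesis using assms
      by (intro has_integral_eqI[OF has_integral_add[OF one t]])
         (auto simp: threshold_def)
  qed
qed

text \<open>For equal signs the minimum is either zero or linear. For \<open>0 \<le> x\<close> and
  \<open>y < 0\<close>, the common \<theta> makes the rounded sum negative only when
  \<open>x < \<theta> \<le> - y\<close>, a set of measure \<open>max (- y - x) 0\<close>.\<close>

lemma has_integral_min_threshold:
  assumes "-1 \<le> x" "x \<le> 1" "-1 \<le> y" "y \<le> 1"
  shows "((\<lambda>\<theta>. min (threshold \<theta> x + threshold \<theta> y) 0) has_integral (min (x + y) 0)) {0..1}"
proof -
  have mixed: "((\<lambda>\<theta>. min (threshold \<theta> x + threshold \<theta> y) 0) has_integral (min (x + y) 0)) {0..1}"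
    if "0 \<le> x" "y < 0" "x \<le> 1" "-1 \<le> y" for x y
  proof -
    have "((\<lambda>\<theta>. of_bool (\<theta> \<le> x) - of_bool (\<theta> \<le> max x (- y))) has_integral (x - max x (- y))) {0..1}"
      using that by (intro has_integral_diff has_integral_of_bool_le) auto
    then show ?thesis using that
      by (elim has_integral_eqI) (auto simp: threshold_def max_def)
  qed
  consider "0 \<le> x" "0 \<le> y" | "x < 0" "y < 0" | "0 \<le> x" "y < 0" | "x < 0" "0 \<le> y" by linarith
  then show ?thesis
  proof cases
    case 1
    then show ?thesis
      by (intro has_integral_eqI[OF has_integral_0]) (auto simp: threshold_def)
  next
    case 2
    have "((\<lambda>\<theta>. threshold \<theta> x + threshold \<theta> y) has_integral (x + y)) {0..1}"
      using assms by (intro has_integral_add has_integral_threshold)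
    then show ?thesis using 2
      by (elim has_integral_eqI) (auto simp: threshold_def)
  next
    case 3
    then show ?thesis using mixed assms by auto
  next
    case 4
    then show ?thesis using mixed[of y x] assms by (simp add: add.commute)
  qed
qed

text \<open>Linearity reduces this to terms in one coordinate (vertices) and in two coordinates
  (edges). Every value under the integral is taken at a label vector, so bounds at labels pass to
  the whole cube.\<close>

lemma has_integral_log_weight_threshold:
  assumes G: "simple_graph V E" and u: "\<And>i. i \<in> V \<Longrightarrow> u i \<in> {-1..1}"
  shows "((\<lambda>\<theta>. log_weight \<tau> V E (\<lambda>i. threshold \<theta> (u i))) has_integral log_weight \<tau> V E u) {0..1}"
  unfolding log_weight_def
proof (intro has_integral_add has_integral_mult_right has_integral_sum)
  fix e assume "e \<in> E"
  with G obtain i j where e: "e = {i, j}" "i \<noteq> j" "i \<in> V" "j \<in> V" by (rule simple_graph_edgeE)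
  then show "((\<lambda>\<theta>. min (\<Sum>i\<in>e. threshold \<theta> (u i)) 0) has_integral min (\<Sum>i\<in>e. u i) 0) {0..1}"
    using has_integral_min_threshold[of "u i" "u j"] u[of i] u[of j] by simp
qed (use u G simple_graph_finite_edges[OF G] in \<open>auto simp: simple_graph_def intro!: has_integral_threshold\<close>)

text \<open>If a coordinate exceeds 1, the other endpoint is at least -1, so the edge sum is
  nonnegative before and after cutting at 1. Only the linear term changes.\<close>

lemma log_weight_truncate:
  assumes G: "simple_graph V E" and u: "\<And>i. i \<in> V \<Longrightarrow> -1 \<le> u i"
  shows "log_weight \<tau> V E u
    = log_weight \<tau> V E (\<lambda>i. min (u i) 1) - (\<tau> - 1) * (\<Sum>i\<in>V. u i - min (u i) 1)"
proof -
  have "min (\<Sum>i\<in>e. u i) 0 = min (\<Sum>i\<in>e. min (u i) 1) 0" if "e \<in> E" for e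
  proof -
    from G that obtain i j where e: "e = {i, j}" "i \<noteq> j" "i \<in> V" "j \<in> V" by (rule simple_graph_edgeE)
    then show ?thesis using u[of i] u[of j] by auto
  qed
  then show ?thesis
    by (simp add: log_weight_def sum_subtractf algebra_simps cong: sum.cong)
qed

text \<open>Among finitely many partitions a unique maximum leaves a positive gap. Label vectors lie
  at bounded distance from \<open>r\<close>, so the gap gives a linear penalty there; rounding
  extends it to the cube, and the slope \<open>1 - \<tau>\<close> of \<open>log_weight\<close>
  extends it beyond 1.\<close>

lemma log_weight_decay:
  fixes V :: "'a set"
  assumes G: "simple_graph V E" and \<tau>: "\<tau> > 1"
    and uniq: "\<exists>!P. P \<in> partitions3 V \<and> partition_value \<tau> E P = B\<^sub>f \<tau> V E"
  obtains c r where "c > 0" "\<forall>i. r i \<in> {-1, 0, 1}"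
    "log_weight \<tau> V E r = (\<tau> - 1) * B\<^sub>f \<tau> V E"
    "\<forall>u. (\<forall>i\<in>V. -1 \<le> u i) \<longrightarrow>
       log_weight \<tau> V E u \<le> (\<tau> - 1) * B\<^sub>f \<tau> V E - c * (\<Sum>i\<in>V. \<bar>u i - r i\<bar>)"
proof -
  have finV: "finite V" using G by (simp add: simple_graph_def)
  let ?B = "B\<^sub>f \<tau> V E" and ?v = "partition_value \<tau> E"
  obtain P where P: "P \<in> partitions3 V" "?v P = ?B"
    and uniq': "\<And>Q. Q \<in> partitions3 V \<Longrightarrow> ?v Q = ?B \<Longrightarrow> Q = P"
    using uniq by blast
  define r where "r = label_of P"
  have r_in: "r i \<in> {-1, 0, 1}" for i
    by (auto simp: r_def label_of_def split: prod.splits)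
  have r_P: "partition_of V r = P"
    using P by (simp add: r_def partition_of_label_of)
  have le_B: "?v Q \<le> ?B" if "Q \<in> partitions3 V" for Q
    using that finite_partitions3[OF finV] by (auto simp: B\<^sub>f_def)
  \<comment> \<open>The inserted 1 keeps \<open>D\<close> nonempty when there is only one partition,
    which happens for empty \<open>V\<close>.\<close>
  define D where "D = insert 1 ((\<lambda>Q. ?B - ?v Q) ` (partitions3 V - {P}))"
  define \<delta> where "\<delta> = Min D"
  have finD: "finite D" "D \<noteq> {}" using finite_partitions3[OF finV] by (auto simp: D_def)
  have "0 < ?B - ?v Q" if "Q \<in> partitions3 V - {P}" for Q
    using that le_B[of Q] uniq'[of Q] by force
  then have \<delta>_pos: "\<delta> > 0"
    using finD by (auto simp: \<delta>_def D_def)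
  have gap: "?v Q \<le> ?B - \<delta>" if "Q \<in> partitions3 V" "Q \<noteq> P" for Q
  proof -
    have "?B - ?v Q \<in> D" using that by (auto simp: D_def)
    then have "\<delta> \<le> ?B - ?v Q" using finD by (simp add: \<delta>_def)
    then show ?thesis by simp
  qed
  \<comment> \<open>\<open>K\<close> bounds the distance between two label vectors, with a margin
    that keeps it positive for empty \<open>V\<close>. The cap by 1 in \<open>c\<close> ensures
    \<open>c \<le> \<tau> - 1\<close>, as needed for coordinates above 1.\<close>
  define K where "K = 2 * (real (card V) + 1)"
  define c where "c = (\<tau> - 1) * min 1 (\<delta> / K)"
  have "K > 0" by (simp add: K_def add_pos_nonneg)
  then have c_pos: "c > 0" using \<tau> \<delta>_pos by (simp add: c_def)
  have lattice: "log_weight \<tau> V E q \<le> (\<tau> - 1) * ?B - c * (\<Sum>i\<in>V. \<bar>q i - r i\<bar>)"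
    if q: "\<And>i. q i \<in> {-1, 0, 1}" for q
  proof (cases "\<forall>i\<in>V. q i = r i")
    case True
    then have "partition_of V q = P" unfolding r_P[symmetric] by (auto simp: partition_of_def)
    with log_weight_partition[OF G \<tau> q] P(2) have "log_weight \<tau> V E q = (\<tau> - 1) * ?B" by simp
    with True show ?thesis by simp
  next
    case False
    then obtain i where i: "i \<in> V" "q i \<noteq> r i" by auto
    have "partition_of V q \<noteq> P"
      using i q[of i] r_def label_of_partition_of by metis
    then have 1: "?v (partition_of V q) \<le> ?B - \<delta>"
      using q by (intro gap partition_of_in_partitions3) auto
    have "(\<Sum>i\<in>V. \<bar>q i - r i\<bar>) \<le> (\<Sum>i\<in>V. 2)"
    proof (intro sum_mono)
      show "\<bar>q i - r i\<bar> \<le> 2" for i using q[of i] r_in[of i] by auto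
    qed
    also have "\<dots> \<le> K" by (simp add: K_def)
    finally have "c * (\<Sum>i\<in>V. \<bar>q i - r i\<bar>) \<le> c * K" using c_pos by simp
    also have "\<dots> \<le> (\<tau> - 1) * (\<delta> / K) * K"
      unfolding c_def using \<tau> \<open>K > 0\<close> by (intro mult_right_mono mult_left_mono) auto
    also have "\<dots> = (\<tau> - 1) * \<delta>" using \<open>K > 0\<close> by simp
    finally have "c * (\<Sum>i\<in>V. \<bar>q i - r i\<bar>) \<le> (\<tau> - 1) * \<delta>" .
    moreover have "(\<tau> - 1) * ?v (partition_of V q) \<le> (\<tau> - 1) * (?B - \<delta>)"
      using 1 \<tau> by simp
    ultimately show ?thesis
      unfolding log_weight_partition[OF G \<tau> q] by (simp add: algebra_simps)
  qed
  \<comment> \<open>Both sides are averages over \<theta> of the corresponding expressions at the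
    rounded point, where \<open>lattice\<close> applies.\<close>
  have cube: "log_weight \<tau> V E u \<le> (\<tau> - 1) * ?B - c * (\<Sum>i\<in>V. \<bar>u i - r i\<bar>)"
    if u: "\<And>i. i \<in> V \<Longrightarrow> u i \<in> {-1..1}" for u
  proof (rule has_integral_le)
    show "((\<lambda>\<theta>. log_weight \<tau> V E (\<lambda>i. threshold \<theta> (u i))) has_integral log_weight \<tau> V E u) {0..1}"
      using G u by (rule has_integral_log_weight_threshold)
    have const: "((\<lambda>\<theta>. (\<tau> - 1) * ?B) has_integral (\<tau> - 1) * ?B) {0..1::real}"
      using has_integral_const_real[of "(\<tau> - 1) * ?B" 0 1] by simp
    show "((\<lambda>\<theta>. (\<tau> - 1) * ?B - c * (\<Sum>i\<in>V. \<bar>threshold \<theta> (u i) - r i\<bar>))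
        has_integral (\<tau> - 1) * ?B - c * (\<Sum>i\<in>V. \<bar>u i - r i\<bar>)) {0..1}"
      using u r_in finV
      by (intro has_integral_diff[OF const] has_integral_mult_right has_integral_sum
           has_integral_abs_threshold_diff) auto
  qed (use lattice threshold_in in auto)
  have "log_weight \<tau> V E u \<le> (\<tau> - 1) * ?B - c * (\<Sum>i\<in>V. \<bar>u i - r i\<bar>)"
    if u: "\<And>i. i \<in> V \<Longrightarrow> -1 \<le> u i" for u
  proof -
    have "c \<le> (\<tau> - 1) * 1" unfolding c_def using \<tau> by (intro mult_left_mono) auto
    \<comment> \<open>Cutting at 1 shortens the distance to \<open>r\<close> by at most the excess
      \<open>u i - min (u i) 1\<close>, and the truncation identity pays for that excess at rate
      \<open>\<tau> - 1\<close>.\<close>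
    have "c * (\<Sum>i\<in>V. \<bar>u i - r i\<bar>)
        \<le> c * (\<Sum>i\<in>V. \<bar>min (u i) 1 - r i\<bar> + (u i - min (u i) 1))"
      using c_pos by (intro mult_left_mono sum_mono) auto
    also have "\<dots> \<le> c * (\<Sum>i\<in>V. \<bar>min (u i) 1 - r i\<bar>) + (\<tau> - 1) * (\<Sum>i\<in>V. u i - min (u i) 1)"
      unfolding sum.distrib distrib_left
      using \<open>c \<le> (\<tau> - 1) * 1\<close> by (intro add_left_mono mult_right_mono sum_nonneg) auto
    finally show ?thesis
      using log_weight_truncate[where u = u, OF G u] cube[of "\<lambda>i. min (u i) 1"] u by fastforce
  qed
  moreover have "log_weight \<tau> V E r = (\<tau> - 1) * ?B"
    using log_weight_partition[OF G \<tau> r_in] r_P P by simp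
  ultimately show thesis using that c_pos r_in by blast
qed

section \<open>One-dimensional integrals\<close>

text \<open>Substituting \<open>v = ln (h / t)\<close> turns this into an integral of
  \<open>exp (- c * \<bar>v\<bar>)\<close> over a half-line. The bound is uniform in
  \<open>t\<close>, which later depends on \<open>n\<close>.\<close>

lemma nn_integral_exp_abs_ln_le:
  fixes a c t :: real
  assumes "0 < a" "a \<le> t" "0 < c"
  shows "(\<integral>\<^sup>+h. ennreal (exp (- c * \<bar>ln (h / t)\<bar>) / h) * indicator {a..} h \<partial>lborel) \<le> ennreal (2 / c)"
proof -
  let ?f = "\<lambda>d h. exp (d * (ln h - ln t)) / h"
  have t: "t > 0" using assms by simp
  have deriv: "((\<lambda>h. exp (d * (ln h - ln t)) / d) has_real_derivative ?f d h) (at h)"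
    if "h > 0" "d \<noteq> 0" for d h :: real
    using that by (auto intro!: derivative_eq_intros simp: field_simps)
  \<comment> \<open>The two pieces overlap at \<open>h = t\<close>, which is harmless for an upper
    bound; each has an explicit antiderivative.\<close>
  have "(\<integral>\<^sup>+h. ennreal (exp (- c * \<bar>ln (h / t)\<bar>) / h) * indicator {a..} h \<partial>lborel)
      \<le> (\<integral>\<^sup>+h. ennreal (?f c h) * indicator {a..t} h + ennreal (?f (- c) h) * indicator {t..} h \<partial>lborel)"
  proof (intro nn_integral_mono)
    fix h :: real
    show "ennreal (exp (- c * \<bar>ln (h / t)\<bar>) / h) * indicator {a..} h
        \<le> ennreal (?f c h) * indicator {a..t} h + ennreal (?f (- c) h) * indicator {t..} h"
    proof (cases "h \<in> {a..}")
      case True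
      then have h: "h > 0" using assms by auto
      show ?thesis
      proof (cases "h \<le> t")
        case le: True
        then have "ln (h / t) \<le> 0" using h t by simp
        then have eq: "exp (- c * \<bar>ln (h / t)\<bar>) / h = ?f c h"
          using h t by (simp add: ln_div algebra_simps)
        show ?thesis unfolding eq using True le by simp
      next
        case False
        then have "ln (h / t) \<ge> 0" using h t by simp
        then have eq: "exp (- c * \<bar>ln (h / t)\<bar>) / h = ?f (- c) h"
          using h t by (simp add: ln_div)
        show ?thesis unfolding eq using True False by simp
      qed
    qed simp
  qed
  also have "\<dots> = (\<integral>\<^sup>+h. ennreal (?f c h) * indicator {a..t} h \<partial>lborel)
      + (\<integral>\<^sup>+h. ennreal (?f (- c) h) * indicator {t..} h \<partial>lborel)"
    by (intro nn_integral_add) auto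
  also have "\<dots> \<le> ennreal (1 / c) + ennreal (1 / c)"
  proof (intro add_mono)
    have "(\<integral>\<^sup>+h. ennreal (?f c h) * indicator {a..t} h \<partial>lborel)
        = ennreal (exp (c * (ln t - ln t)) / c - exp (c * (ln a - ln t)) / c)"
      using assms by (intro nn_integral_FTC_Icc) (auto intro!: DERIV_subset[OF deriv])
    also have "\<dots> \<le> ennreal (1 / c)"
      using assms by (intro ennreal_leI) simp
    finally show "(\<integral>\<^sup>+h. ennreal (?f c h) * indicator {a..t} h \<partial>lborel) \<le> ennreal (1 / c)" .
    have "(\<integral>\<^sup>+h. ennreal (?f (- c) h) * indicator {t..} h \<partial>lborel)
        = ennreal (0 / (- c) - exp (- c * (ln t - ln t)) / (- c))"
    proof (rule nn_integral_FTC_atLeast[where F = "\<lambda>h. exp (- c * (ln h - ln t)) / (- c)"])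
      have "filterlim (\<lambda>h. c * (- ln t + ln h)) at_top at_top"
        using assms by (intro filterlim_tendsto_pos_mult_at_top[OF tendsto_const]
            filterlim_tendsto_add_at_top[OF tendsto_const] ln_at_top)
      then have "filterlim (\<lambda>h. - c * (ln h - ln t)) at_bot at_top"
        unfolding filterlim_uminus_at_top by (simp add: algebra_simps)
      then have "((\<lambda>h. exp (- c * (ln h - ln t))) \<longlongrightarrow> 0) at_top"
        by (rule filterlim_compose[OF exp_at_bot])
      then show "((\<lambda>h. exp (- c * (ln h - ln t)) / (- c)) \<longlongrightarrow> 0 / (- c)) at_top"
        using assms by (intro tendsto_divide tendsto_const) auto
    qed (use assms deriv[of _ "- c"] in auto)
    then show "(\<integral>\<^sup>+h. ennreal (?f (- c) h) * indicator {t..} h \<partial>lborel) \<le> ennreal (1 / c)"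
      by simp
  qed
  also have "\<dots> = ennreal (2 / c)"
    using assms by (simp flip: ennreal_plus)
  finally show ?thesis .
qed

text \<open>The power \<open>(h / s) powr (\<tau> - 1)\<close> cancels the density up to
  \<open>s powr (1 - \<tau>) / h\<close>, which leaves the logarithmic measure of
  \<open>nn_integral_exp_abs_ln_le\<close>.\<close>

lemma nn_integral_hv_dist_upper:
  assumes "a > 0" "\<tau> > 1" "s > 0" "a \<le> t" "c > 0"
  shows "(\<integral>\<^sup>+h. ennreal ((h / s) powr (\<tau> - 1) * exp (- c * \<bar>ln (h / t)\<bar>)) \<partial>hv_dist \<tau> a)
    \<le> ennreal (hv_const \<tau> a * s powr (1 - \<tau>) * (2 / c))"
proof -
  have C: "hv_const \<tau> a \<ge> 0" using assms by (simp add: hv_const_eq)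
  have "(\<integral>\<^sup>+h. ennreal ((h / s) powr (\<tau> - 1) * exp (- c * \<bar>ln (h / t)\<bar>)) \<partial>hv_dist \<tau> a)
     = (\<integral>\<^sup>+h. ennreal (hv_density \<tau> a h)
          * ennreal ((h / s) powr (\<tau> - 1) * exp (- c * \<bar>ln (h / t)\<bar>)) \<partial>lborel)"
    unfolding hv_dist_def by (rule nn_integral_density) auto
  also have "\<dots> = (\<integral>\<^sup>+h. ennreal (hv_const \<tau> a * s powr (1 - \<tau>)) *
        (ennreal (exp (- c * \<bar>ln (h / t)\<bar>) / h) * indicator {a..} h) \<partial>lborel)"
  proof (intro nn_integral_cong)
    fix h :: real
    have "hv_density \<tau> a h * ((h / s) powr (\<tau> - 1) * exp (- c * \<bar>ln (h / t)\<bar>))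
      = hv_const \<tau> a * s powr (1 - \<tau>) * (exp (- c * \<bar>ln (h / t)\<bar>) / h)" if "a \<le> h"
    proof -
      have "h powr (- \<tau>) * (h / s) powr (\<tau> - 1) = h powr (- \<tau> + (\<tau> - 1)) * s powr (1 - \<tau>)"
        using that assms by (simp only: powr_divide powr_add) (simp add: powr_minus powr_diff field_simps)
      also have "h powr (- \<tau> + (\<tau> - 1)) = 1 / h"
        using that assms by (simp add: powr_minus_divide)
      finally have eq: "h powr (- \<tau>) * (h / s) powr (\<tau> - 1) = 1 / h * s powr (1 - \<tau>)" .
      have "hv_density \<tau> a h * ((h / s) powr (\<tau> - 1) * exp (- c * \<bar>ln (h / t)\<bar>))
        = hv_const \<tau> a * (h powr (- \<tau>) * (h / s) powr (\<tau> - 1)) * exp (- c * \<bar>ln (h / t)\<bar>)"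
        using that by (simp add: hv_density_def)
      then show ?thesis unfolding eq by simp
    qed
    then show "ennreal (hv_density \<tau> a h) * ennreal ((h / s) powr (\<tau> - 1) * exp (- c * \<bar>ln (h / t)\<bar>))
        = ennreal (hv_const \<tau> a * s powr (1 - \<tau>)) *
           (ennreal (exp (- c * \<bar>ln (h / t)\<bar>) / h) * indicator {a..} h)"
      using assms C by (cases "a \<le> h")
        (auto simp: hv_density_nonneg hv_density_def[of \<tau> a h] simp flip: ennreal_mult')
  qed
  also have "\<dots> = ennreal (hv_const \<tau> a * s powr (1 - \<tau>)) *
      (\<integral>\<^sup>+h. ennreal (exp (- c * \<bar>ln (h / t)\<bar>) / h) * indicator {a..} h \<partial>lborel)"
    by (intro nn_integral_cmult) auto
  also have "\<dots> \<le> ennreal (hv_const \<tau> a * s powr (1 - \<tau>)) * ennreal (2 / c)"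
    using assms by (intro mult_left_mono nn_integral_exp_abs_ln_le) auto
  also have "\<dots> = ennreal (hv_const \<tau> a * s powr (1 - \<tau>) * (2 / c))"
    using assms C by (intro ennreal_mult[symmetric]) auto
  finally show ?thesis .
qed

text \<open>On an interval of length \<open>t\<close> the density is at least its value at
  \<open>2 * t\<close>, and all powers of \<open>t\<close> cancel. The result has the same order in
  \<open>s\<close> as the upper bound, wherever the interval lies.\<close>

lemma nn_integral_hv_dist_lower:
  assumes "a > 0" "\<tau> > 1" "s > 0" "a \<le> t"
  shows "ennreal (hv_const \<tau> a * s powr (1 - \<tau>) * 2 powr (- \<tau>))
    \<le> (\<integral>\<^sup>+h. ennreal ((t / s) powr (\<tau> - 1)) * indicator {t..2 * t} h \<partial>hv_dist \<tau> a)"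
proof -
  have C: "hv_const \<tau> a \<ge> 0" and t: "t > 0" using assms by (auto simp: hv_const_eq)
  have "hv_const \<tau> a * s powr (1 - \<tau>) * 2 powr (- \<tau>)
      = hv_const \<tau> a * (2 * t) powr (- \<tau>) * (t / s) powr (\<tau> - 1) * t"
  proof -
    have "t powr (- \<tau>) * t powr (\<tau> - 1) * t = 1"
      using t powr_add[of t "- \<tau>" "\<tau> - 1"] by (simp add: powr_minus field_simps)
    moreover have "(2 * t) powr (- \<tau>) * (t / s) powr (\<tau> - 1) * t
        = 2 powr (- \<tau>) * (t powr (- \<tau>) * t powr (\<tau> - 1) * t) * s powr (1 - \<tau>)"
      using t assms powr_minus[of s "\<tau> - 1"] by (simp add: powr_mult powr_divide field_simps)
    ultimately show ?thesis by (simp add: mult_ac)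
  qed
  then have "ennreal (hv_const \<tau> a * s powr (1 - \<tau>) * 2 powr (- \<tau>))
      = ennreal (hv_const \<tau> a * (2 * t) powr (- \<tau>) * (t / s) powr (\<tau> - 1)) * emeasure lborel {t..2 * t}"
    using t C by (simp flip: ennreal_mult)
  also have "\<dots> = (\<integral>\<^sup>+h. ennreal (hv_const \<tau> a * (2 * t) powr (- \<tau>) * (t / s) powr (\<tau> - 1))
      * indicator {t..2 * t} h \<partial>lborel)"
    by (intro nn_integral_cmult_indicator[symmetric]) auto
  also have "\<dots> \<le> (\<integral>\<^sup>+h. ennreal (hv_density \<tau> a h)
      * (ennreal ((t / s) powr (\<tau> - 1)) * indicator {t..2 * t} h) \<partial>lborel)"
  proof (intro nn_integral_mono)
    fix h :: real
    show "ennreal (hv_const \<tau> a * (2 * t) powr (- \<tau>) * (t / s) powr (\<tau> - 1)) * indicator {t..2 * t} h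
       \<le> ennreal (hv_density \<tau> a h) * (ennreal ((t / s) powr (\<tau> - 1)) * indicator {t..2 * t} h)"
    proof (cases "h \<in> {t..2 * t}")
      case True
      then have "(2 * t) powr (- \<tau>) \<le> h powr (- \<tau>)"
        using t assms by (intro powr_mono2') auto
      then have "hv_const \<tau> a * (2 * t) powr (- \<tau>) \<le> hv_density \<tau> a h"
        using True assms C by (auto simp: hv_density_def intro: mult_left_mono)
      then show ?thesis
        using True C by (auto simp: hv_density_nonneg assms simp flip: ennreal_mult
            intro!: ennreal_leI mult_right_mono)
    qed simp
  qed
  also have "\<dots> = (\<integral>\<^sup>+h. ennreal ((t / s) powr (\<tau> - 1)) * indicator {t..2 * t} h \<partial>hv_dist \<tau> a)"
    unfolding hv_dist_def by (intro nn_integral_density[symmetric]) auto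
  finally show ?thesis .
qed

section \<open>The expected count as a sum over embeddings\<close>

definition embeddings :: "'a set \<Rightarrow> nat \<Rightarrow> ('a \<Rightarrow> nat) set" where
  "embeddings V n = {\<phi> \<in> V \<rightarrow>\<^sub>E {..<n}. inj_on \<phi> V}"

lemma finite_embeddings: "finite V \<Longrightarrow> finite (embeddings V n)"
  by (rule finite_subset[OF _ finite_PiE[of V "\<lambda>_. {..<n}"]]) (auto simp: embeddings_def)

lemma card_embeddings:
  assumes "finite V"
  shows "card (embeddings V n) = (\<Prod>i<card V. n - i)"
  using card_inj_on_subset_funcset[OF assms, of "{..<n}" V]
  by (simp add: embeddings_def atLeast0LessThan)

lemma card_embeddings_le:
  assumes "finite V"
  shows "real (card (embeddings V n)) \<le> real n ^ card V"
proof -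
  have "(\<Prod>i<card V. real (n - i)) \<le> (\<Prod>i<card V. real n)" by (intro prod_mono) auto
  then show ?thesis using assms by (simp add: card_embeddings)
qed

lemma card_embeddings_ge:
  assumes "finite V" "2 * card V \<le> n"
  shows "(real n / 2) ^ card V \<le> real (card (embeddings V n))"
proof -
  have "(\<Prod>i<card V. real n / 2) \<le> (\<Prod>i<card V. real (n - i))"
    using assms by (intro prod_mono) (auto simp: of_nat_diff)
  then show ?thesis using assms by (simp add: card_embeddings)
qed

text \<open>Edges are mapped as sets, so the condition is indexed by \<open>E\<close> itself and
  each edge is tested once.\<close>

definition realizes :: "'a set set \<Rightarrow> ('a \<Rightarrow> nat) \<Rightarrow> nat set set \<Rightarrow> bool" where
  "realizes E \<phi> G \<longleftrightarrow> (\<forall>e\<in>E. \<phi> ` e \<in> G)"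

lemma motif_count_eq_sum:
  assumes "simple_graph V E"
  shows "real (motif_count V E n G) = (\<Sum>\<phi>\<in>embeddings V n. of_bool (realizes E \<phi> G))"
proof -
  have 1: "(\<forall>i\<in>V. \<forall>j\<in>V. {i, j} \<in> E \<longrightarrow> {\<phi> i, \<phi> j} \<in> G) \<longleftrightarrow> realizes E \<phi> G" for \<phi> :: "'a \<Rightarrow> nat"
  proof
    assume *: "\<forall>i\<in>V. \<forall>j\<in>V. {i, j} \<in> E \<longrightarrow> {\<phi> i, \<phi> j} \<in> G"
    show "realizes E \<phi> G"
      unfolding realizes_def
    proof
      fix e assume e: "e \<in> E"
      then have "e \<subseteq> V" "card e = 2" using assms by (auto simp: simple_graph_def)
      then obtain i j where "e = {i, j}" "i \<in> V" "j \<in> V" by (auto simp: card_2_iff)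
      with * e show "\<phi> ` e \<in> G" by auto
    qed
  next
    assume "realizes E \<phi> G"
    then show "\<forall>i\<in>V. \<forall>j\<in>V. {i, j} \<in> E \<longrightarrow> {\<phi> i, \<phi> j} \<in> G"
      unfolding realizes_def by force
  qed
  have "finite (embeddings V n)"
    using assms by (auto simp: simple_graph_def finite_embeddings)
  moreover have "{\<phi> \<in> V \<rightarrow>\<^sub>E {..<n}. inj_on \<phi> V \<and> realizes E \<phi> G} = {\<phi> \<in> embeddings V n. realizes E \<phi> G}"
    by (auto simp: embeddings_def)
  ultimately show ?thesis
    unfolding motif_count_def 1 by (simp add: of_bool_def sum.If_cases Int_def)
qed

text \<open>An injective \<open>\<phi>\<close> sends distinct edges to distinct vertex pairs, so the
  event fixes one independent coin per edge. Nonnegativity of \<open>h\<close> and \<mu> makes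
  \<open>edge_prob\<close> a genuine probability, so the Bernoulli parameter is not clamped.\<close>

lemma emeasure_realizes:
  fixes \<phi> :: "'a \<Rightarrow> nat"
  assumes G: "simple_graph V E" and \<phi>: "\<phi> \<in> embeddings V n"
    and h: "\<And>v. v < n \<Longrightarrow> 0 \<le> h v" and \<mu>: "0 \<le> \<mu>"
  shows "emeasure (measure_pmf (hv_graph_given \<mu> n h)) {G. realizes E \<phi> G}
    = ennreal (\<Prod>e\<in>E. min ((\<Prod>i\<in>e. h (\<phi> i)) / (\<mu> * real n)) 1)"
proof -
  let ?P = "{(u, v). u < v \<and> v < n}"
  let ?p = "\<lambda>(u, v). bernoulli_pmf (edge_prob \<mu> n (h u) (h v))"
  let ?q = "\<lambda>e. min ((\<Prod>w\<in>e. h w) / (\<mu> * real n)) 1"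
  \<comment> \<open>\<open>pair\<close> passes from the index of a coin to its edge;
    \<open>T\<close> collects the coins that have to show an edge.\<close>
  define pair where "pair = (\<lambda>(u :: nat, v). {u, v})"
  define T where "T = {x \<in> ?P. pair x \<in> (`) \<phi> ` E}"
  have inj: "inj_on \<phi> V" and ran: "\<phi> ` V \<subseteq> {..<n}"
    using \<phi> by (auto simp: embeddings_def)
  have inj_pair: "inj_on pair ?P"
    by (auto simp: inj_on_def pair_def doubleton_eq_iff)
  have pair_T: "pair ` T = (`) \<phi> ` E"
  proof (intro equalityI subsetI)
    fix f assume "f \<in> (`) \<phi> ` E"
    then obtain e where e: "e \<in> E" "f = \<phi> ` e" by auto
    then have "e \<subseteq> V" "card e = 2" using G by (auto simp: simple_graph_def)
    then obtain i j where ij: "e = {i, j}" "i \<noteq> j" "i \<in> V" "j \<in> V" by (auto simp: card_2_iff)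
    then have ne: "\<phi> i \<noteq> \<phi> j" and lt: "\<phi> i < n" "\<phi> j < n" using inj ran by (auto dest: inj_onD)
    define x where "x = (min (\<phi> i) (\<phi> j), max (\<phi> i) (\<phi> j))"
    have "pair x = f" "x \<in> ?P"
      using ne lt e ij by (auto simp: x_def pair_def min_def max_def)
    then show "f \<in> pair ` T" using e by (auto simp: T_def)
  qed (auto simp: T_def)
  \<comment> \<open>The event is a product set whose coordinates outside \<open>T\<close> are
    unrestricted and contribute the factor 1.\<close>
  have "{b. realizes E \<phi> {{u, v} | u v. u < v \<and> v < n \<and> b (u, v)}}
      = Pi ?P (\<lambda>x. {c. x \<in> T \<longrightarrow> c})"
  proof (intro set_eqI)
    fix b :: "nat \<times> nat \<Rightarrow> bool"
    define G' where "G' = {{u, v} | u v. u < v \<and> v < n \<and> b (u, v)}"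
    have "G' = pair ` {x \<in> ?P. b x}" by (auto simp: pair_def G'_def)
    then have G': "pair x \<in> G' \<longleftrightarrow> b x" if "x \<in> T" for x
      using that inj_on_image_mem_iff[OF inj_pair, of x "{x \<in> ?P. b x}"] by (auto simp: T_def)
    have "realizes E \<phi> G' \<longleftrightarrow> (\<forall>f\<in>pair ` T. f \<in> G')"
      unfolding pair_T realizes_def by simp
    also have "\<dots> \<longleftrightarrow> (\<forall>x\<in>T. b x)"
      using G' by simp
    finally have "realizes E \<phi> {{u, v} | u v. u < v \<and> v < n \<and> b (u, v)} \<longleftrightarrow> (\<forall>x\<in>T. b x)"
      unfolding G'_def .
    then show "b \<in> {b. realizes E \<phi> {{u, v} | u v. u < v \<and> v < n \<and> b (u, v)}}
        \<longleftrightarrow> b \<in> Pi ?P (\<lambda>x. {c. x \<in> T \<longrightarrow> c})"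
      by (auto simp: T_def Pi_iff)
  qed
  then have "emeasure (measure_pmf (hv_graph_given \<mu> n h)) {G. realizes E \<phi> G}
      = emeasure (Pi_pmf ?P False ?p) (Pi ?P (\<lambda>x. {c. x \<in> T \<longrightarrow> c}))"
    by (simp add: hv_graph_given_def vimage_def)
  also have "\<dots> = ennreal (\<Prod>x\<in>?P. measure_pmf.prob (?p x) {c. x \<in> T \<longrightarrow> c})"
    by (simp only: measure_pmf.emeasure_eq_measure measure_Pi_pmf_Pi[OF finite_pairs])
  also have "(\<Prod>x\<in>?P. measure_pmf.prob (?p x) {c. x \<in> T \<longrightarrow> c}) = (\<Prod>x\<in>?P. if x \<in> T then ?q (pair x) else 1)"
  proof (intro prod.cong refl)
    fix x assume "x \<in> ?P"
    then obtain u v where x: "x = (u, v)" "u < v" "v < n" by auto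
    then have q: "?q (pair x) = edge_prob \<mu> n (h u) (h v)"
      by (simp add: pair_def edge_prob_def)
    have "edge_prob \<mu> n (h u) (h v) \<in> {0..1}"
      using x h[of u] h[of v] \<mu> by (auto simp: edge_prob_def)
    then have "measure_pmf.prob (bernoulli_pmf (edge_prob \<mu> n (h u) (h v))) {True} = edge_prob \<mu> n (h u) (h v)"
      by (simp add: measure_pmf_single)
    moreover have "{c. c} = {True}" by auto
    ultimately show "measure_pmf.prob (?p x) {c. x \<in> T \<longrightarrow> c} = (if x \<in> T then ?q (pair x) else 1)"
      unfolding q by (simp add: x)
  qed
  also have "\<dots> = (\<Prod>x\<in>T. ?q (pair x))"
    using finite_pairs[of n] by (simp add: prod.If_cases T_def Int_def)
  also have "\<dots> = (\<Prod>f\<in>(`) \<phi> ` E. ?q f)"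
    unfolding pair_T[symmetric]
    by (rule prod.reindex_cong[symmetric, OF _ refl refl]) (rule inj_on_subset[OF inj_pair], auto simp: T_def)
  also have "\<dots> = (\<Prod>e\<in>E. ?q (\<phi> ` e))"
  proof (rule prod.reindex_cong[OF _ refl refl])
    have "E \<subseteq> Pow V" using G by (auto simp: simple_graph_def)
    then show "inj_on ((`) \<phi>) E"
      using inj_on_image_Pow[OF inj] inj_on_subset by blast
  qed
  also have "\<dots> = (\<Prod>e\<in>E. min ((\<Prod>i\<in>e. h (\<phi> i)) / (\<mu> * real n)) 1)"
  proof (intro prod.cong refl)
    fix e assume "e \<in> E"
    then have "inj_on \<phi> e" using G inj by (auto simp: simple_graph_def intro: inj_on_subset)
    then show "?q (\<phi> ` e) = min ((\<Prod>i\<in>e. h (\<phi> i)) / (\<mu> * real n)) 1"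
      by (simp add: prod.reindex)
  qed
  finally show ?thesis .
qed

lemma AE_hv_dist_ge: "AE h in hv_dist \<tau> a. a \<le> h"
  unfolding hv_dist_def by (subst AE_density) (auto simp: hv_density_def intro!: AE_I2)

lemma AE_PiM_hv_dist_ge:
  fixes n :: nat
  assumes "a > 0" "\<tau> > 1"
  shows "AE h in (\<Pi>\<^sub>M v\<in>{..<n}. hv_dist \<tau> a). \<forall>v<n. a \<le> h v"
proof -
  have "AE h in (\<Pi>\<^sub>M v\<in>{..<n}. hv_dist \<tau> a). \<forall>v\<in>{..<n}. a \<le> h v"
    using assms by (intro AE_finite_allI AE_PiM_component prob_space_hv_dist AE_hv_dist_ge) auto
  then show ?thesis by (simp add: Ball_def)
qed

text \<open>The count is a sum of indicators over embeddings, so the expectation splits by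
  integrating first over the coins and then over the hidden variables.\<close>

lemma expected_motif_count_eq:
  assumes G: "simple_graph V E" and a: "a > 0" and \<tau>: "\<tau> > 2"
  shows "expected_motif_count \<tau> a V E n =
    enn2real (\<Sum>\<phi>\<in>embeddings V n. \<integral>\<^sup>+h. ennreal (\<Prod>e\<in>E. min ((\<Prod>i\<in>e. h (\<phi> i)) / (hv_mean \<tau> a * real n)) 1)
      \<partial>(\<Pi>\<^sub>M v\<in>{..<n}. hv_dist \<tau> a))"
proof -
  let ?M = "\<Pi>\<^sub>M v\<in>{..<n}. hv_dist \<tau> a" and ?K = "\<lambda>h. measure_pmf (hv_graph_given (hv_mean \<tau> a) n h)"
  have \<mu>: "hv_mean \<tau> a > 0" using a \<tau> by (simp add: hv_mean_eq)
  have fin: "finite (embeddings V n)" using G by (auto simp: simple_graph_def finite_embeddings)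
  have meas: "(\<lambda>h. emeasure (?K h) {G. realizes E \<phi> G}) \<in> borel_measurable ?M" for \<phi>
    using measurable_compose[OF measurable_hv_graph_given measurable_emeasure_subprob_algebra] by simp
  have sets: "sets (hv_graph \<tau> a n) = sets (count_space UNIV)"
    using sets_hv_graph[of a \<tau> n] a \<tau> by simp
  have "expected_motif_count \<tau> a V E n = enn2real (\<integral>\<^sup>+G. ennreal (real (motif_count V E n G)) \<partial>hv_graph \<tau> a n)"
    unfolding expected_motif_count_def
    by (intro integral_eq_nn_integral) (auto simp: measurable_cong_sets[OF sets refl])
  also have "(\<integral>\<^sup>+G. ennreal (real (motif_count V E n G)) \<partial>hv_graph \<tau> a n)
      = (\<integral>\<^sup>+h. \<integral>\<^sup>+G. ennreal (real (motif_count V E n G)) \<partial>?K h \<partial>?M)"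
    unfolding hv_graph_def by (rule nn_integral_bind[OF _ measurable_hv_graph_given]) simp
  also have "\<dots> = (\<integral>\<^sup>+h. (\<Sum>\<phi>\<in>embeddings V n. emeasure (?K h) {G. realizes E \<phi> G}) \<partial>?M)"
  proof (intro nn_integral_cong)
    fix h
    have "(\<integral>\<^sup>+G. ennreal (real (motif_count V E n G)) \<partial>?K h)
        = (\<integral>\<^sup>+G. (\<Sum>\<phi>\<in>embeddings V n. indicator {G. realizes E \<phi> G} G) \<partial>?K h)"
      unfolding motif_count_eq_sum[OF G]
    proof (intro nn_integral_cong)
      fix G
      have "ennreal (\<Sum>\<phi>\<in>embeddings V n. of_bool (realizes E \<phi> G))
          = (\<Sum>\<phi>\<in>embeddings V n. ennreal (of_bool (realizes E \<phi> G)))"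
        by (rule sum_ennreal[symmetric]) simp
      also have "\<dots> = (\<Sum>\<phi>\<in>embeddings V n. indicator {G. realizes E \<phi> G} G)"
        by (intro sum.cong refl) (simp add: indicator_def)
      finally show "ennreal (\<Sum>\<phi>\<in>embeddings V n. of_bool (realizes E \<phi> G)) = \<dots>" .
    qed
    also have "\<dots> = (\<Sum>\<phi>\<in>embeddings V n. emeasure (?K h) {G. realizes E \<phi> G})"
      by (subst nn_integral_sum) auto
    finally show "(\<integral>\<^sup>+G. ennreal (real (motif_count V E n G)) \<partial>?K h) = \<dots>" .
  qed
  also have "\<dots> = (\<Sum>\<phi>\<in>embeddings V n. \<integral>\<^sup>+h. emeasure (?K h) {G. realizes E \<phi> G} \<partial>?M)"
    by (intro nn_integral_sum meas)
  also have "\<dots> = (\<Sum>\<phi>\<in>embeddings V n. \<integral>\<^sup>+h. ennreal (\<Prod>e\<in>E. min ((\<Prod>i\<in>e. h (\<phi> i)) / (hv_mean \<tau> a * real n)) 1) \<partial>?M)"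
  \<comment> \<open>The product formula needs nonnegative hidden variables, which hold only almost
    everywhere.\<close>
  proof (intro sum.cong refl nn_integral_cong_AE)
    fix \<phi> assume \<phi>: "\<phi> \<in> embeddings V n"
    have "AE h in ?M. \<forall>v<n. a \<le> h v" using a \<tau> by (intro AE_PiM_hv_dist_ge) auto
    then show "AE h in ?M. emeasure (?K h) {G. realizes E \<phi> G}
        = ennreal (\<Prod>e\<in>E. min ((\<Prod>i\<in>e. h (\<phi> i)) / (hv_mean \<tau> a * real n)) 1)"
    proof eventually_elim
      case (elim h)
      have "0 \<le> h v" if "v < n" for v using elim that a by force
      then show ?case using \<mu> by (intro emeasure_realizes[OF G \<phi>]) auto
    qed
  qed
  finally show ?thesis .
qed

text \<open>The coordinates \<open>\<phi> i\<close> are distinct, hence independent; the remaining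
  ones integrate to 1.\<close>

lemma nn_integral_PiM_prod_embedding:
  assumes M: "prob_space M" and V: "finite V" and \<phi>: "\<phi> \<in> embeddings V n"
    and g: "\<And>i. i \<in> V \<Longrightarrow> g i \<in> borel_measurable M"
  shows "(\<integral>\<^sup>+h. (\<Prod>i\<in>V. g i (h (\<phi> i))) \<partial>(\<Pi>\<^sub>M v\<in>{..<n}. M)) = (\<Prod>i\<in>V. \<integral>\<^sup>+x. g i x \<partial>M)"
proof -
  interpret M: prob_space M by fact
  interpret product_sigma_finite "\<lambda>_ :: nat. M" by standard
  have inj: "inj_on \<phi> V" and ran: "\<phi> ` V \<subseteq> {..<n}" using \<phi> by (auto simp: embeddings_def)
  define f where "f v = (if v \<in> \<phi> ` V then g (the_inv_into V \<phi> v) else (\<lambda>_. 1))" for v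
  have f_\<phi>: "f (\<phi> i) = g i" if "i \<in> V" for i
    using that by (simp add: f_def the_inv_into_f_f[OF inj])
  have f: "f v \<in> borel_measurable M" for v
  proof (cases "v \<in> \<phi> ` V")
    case True
    then show ?thesis using g f_\<phi> by auto
  next
    case False
    then show ?thesis by (simp add: f_def)
  qed
  \<comment> \<open>The functional \<open>F\<close> allows the same reindexing to serve twice, once
    for evaluation at \<open>h\<close> and once for integration over \<open>M\<close>.\<close>
  have prod_f: "(\<Prod>i\<in>V. F (g i) (\<phi> i)) = (\<Prod>v<n. F (f v) v)"
    if "\<And>v. F (\<lambda>_. 1) v = 1" for F :: "_ \<Rightarrow> nat \<Rightarrow> ennreal"
  proof -
    have "(\<Prod>v<n. F (f v) v) = (\<Prod>v\<in>\<phi> ` V. F (f v) v)"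
      using ran that by (intro prod.mono_neutral_right) (auto simp: f_def)
    also have "\<dots> = (\<Prod>i\<in>V. F (g i) (\<phi> i))"
      using f_\<phi> inj by (simp add: prod.reindex)
    finally show ?thesis by simp
  qed
  have "(\<integral>\<^sup>+h. (\<Prod>i\<in>V. g i (h (\<phi> i))) \<partial>(\<Pi>\<^sub>M v\<in>{..<n}. M)) = (\<integral>\<^sup>+h. (\<Prod>v<n. f v (h v)) \<partial>(\<Pi>\<^sub>M v\<in>{..<n}. M))"
    using prod_f[of "\<lambda>f v. f (h v)" for h] by simp
  also have "\<dots> = (\<Prod>v<n. \<integral>\<^sup>+x. f v x \<partial>M)"
    using f by (intro product_nn_integral_prod) auto
  also have "\<dots> = (\<Prod>i\<in>V. \<integral>\<^sup>+x. g i x \<partial>M)"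
    using prod_f[of "\<lambda>f v. \<integral>\<^sup>+x. f x \<partial>M"] by (simp add: M.emeasure_space_1)
  finally show ?thesis .
qed

section \<open>Asymptotics\<close>

text \<open>With \<open>u i = ln (x i) / L\<close>, each edge factor is the exponential of
  \<open>L\<close> times its edge term. The linear part of \<open>log_weight\<close> is compensated
  by the powers \<open>x i powr (\<tau> - 1)\<close>, the factors that cancel against the
  density.\<close>

lemma prod_min_edges_eq_exp:
  assumes G: "simple_graph V E" and x: "\<And>i. i \<in> V \<Longrightarrow> x i > 0" and L: "L > 0"
  shows "(\<Prod>e\<in>E. min (\<Prod>i\<in>e. x i) 1)
    = exp (L * log_weight \<tau> V E (\<lambda>i. ln (x i) / L)) * (\<Prod>i\<in>V. x i powr (\<tau> - 1))"
proof -
  let ?u = "\<lambda>i. ln (x i) / L"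
  have finV: "finite V" and finE: "finite E"
    using G simple_graph_finite_edges by (auto simp: simple_graph_def)
  have "(\<Prod>e\<in>E. min (\<Prod>i\<in>e. x i) 1) = (\<Prod>e\<in>E. exp (L * min (\<Sum>i\<in>e. ?u i) 0))"
  proof (intro prod.cong refl)
    fix e assume "e \<in> E"
    then have e: "e \<subseteq> V" "finite e" using G finV by (auto simp: simple_graph_def intro: finite_subset)
    have "(\<Prod>i\<in>e. x i) = (\<Prod>i\<in>e. exp (ln (x i)))"
      using x e by (intro prod.cong refl) auto
    also have "\<dots> = exp (L * (\<Sum>i\<in>e. ?u i))"
      using e L by (simp add: exp_sum flip: sum_divide_distrib)
    finally show "min (\<Prod>i\<in>e. x i) 1 = exp (L * min (\<Sum>i\<in>e. ?u i) 0)"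
      using L by (simp add: min_def zero_less_mult_iff mult_le_0_iff)
  qed
  also have "\<dots> = exp (L * (\<Sum>e\<in>E. min (\<Sum>i\<in>e. ?u i) 0))"
    using finE by (simp add: exp_sum sum_distrib_left)
  also have "\<dots> = exp (L * log_weight \<tau> V E ?u + (\<tau> - 1) * (\<Sum>i\<in>V. ln (x i)))"
  proof -
    have "(\<Sum>i\<in>V. ln (x i)) = L * (\<Sum>i\<in>V. ?u i)" using L by (simp flip: sum_divide_distrib)
    then show ?thesis by (simp only: log_weight_def) (simp add: algebra_simps)
  qed
  also have "\<dots> = exp (L * log_weight \<tau> V E ?u) * (\<Prod>i\<in>V. exp ((\<tau> - 1) * ln (x i)))"
    using finV by (simp add: exp_add exp_sum sum_distrib_left)
  also have "(\<Prod>i\<in>V. exp ((\<tau> - 1) * ln (x i))) = (\<Prod>i\<in>V. x i powr (\<tau> - 1))"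
    using x by (intro prod.cong refl) (force simp: powr_def)
  finally show ?thesis .
qed

text \<open>An edge has two endpoints, so each can absorb one factor \<open>sqrt m\<close>.\<close>

lemma edge_weight_rescale:
  assumes "simple_graph V E" "e \<in> E" "m \<ge> 0"
  shows "(\<Prod>i\<in>e. f i) / m = (\<Prod>i\<in>e. f i / sqrt m)"
  using assms by (auto simp: prod_dividef simple_graph_def)

text \<open>\<open>decay\<close> dominates the edge product by a product of functions of single
  coordinates, so the integral factorizes. In a box at the optimal scales the edge product has the
  same order, and both bounds differ only in their constants. The condition on \<open>n\<close>
  gives \<open>s > a\<close>, so that \<open>L > 0\<close>.\<close>

lemma embedding_integral_bounds:
  fixes V :: "'a set"
  assumes G: "simple_graph V E" and a: "a > 0" and \<tau>: "\<tau> > 2" and c: "c > 0"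
    and r: "\<forall>i. r i \<in> {-1, 0, 1}" and r_opt: "log_weight \<tau> V E r = b"
    and decay: "\<forall>u. (\<forall>i\<in>V. -1 \<le> u i) \<longrightarrow>
       log_weight \<tau> V E u \<le> b - c * (\<Sum>i\<in>V. \<bar>u i - r i\<bar>)"
    and n: "hv_mean \<tau> a * real n > a\<^sup>2" and \<phi>: "\<phi> \<in> embeddings V n"
  defines "s \<equiv> sqrt (hv_mean \<tau> a * real n)"
  defines "J \<equiv> \<integral>\<^sup>+h. ennreal (\<Prod>e\<in>E. min ((\<Prod>i\<in>e. h (\<phi> i)) / (hv_mean \<tau> a * real n)) 1)
      \<partial>(\<Pi>\<^sub>M v\<in>{..<n}. hv_dist \<tau> a)"
  shows "J \<le> ennreal ((s / a) powr b * (hv_const \<tau> a * s powr (1 - \<tau>) * (2 / c)) ^ card V)"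
    and "ennreal ((s / a) powr b * (hv_const \<tau> a * s powr (1 - \<tau>) * 2 powr (- \<tau>)) ^ card V) \<le> J"
proof -
  let ?M = "hv_dist \<tau> a"
  let ?P = "\<Pi>\<^sub>M v\<in>{..<n}. ?M"
  have finV: "finite V" using G by (simp add: simple_graph_def)
  have C: "hv_const \<tau> a \<ge> 0" using a \<tau> by (simp add: hv_const_eq)
  have M: "prob_space ?M" using a \<tau> by (intro prob_space_hv_dist) auto
  have s_gt: "s > a" unfolding s_def using n a by (intro real_less_rsqrt) auto
  then have s: "s > 0" using a by simp
  define L where "L = ln (s / a)"
  have L: "L > 0" using s_gt a by (simp add: L_def)
  have exp_L: "exp (L * x) = (s / a) powr x" for x
    using s a by (simp add: L_def powr_def mult.commute)
  \<comment> \<open>The optimal scales: \<open>t i\<close> is \<open>a\<close>, \<open>s\<close> or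
    \<open>s * s / a\<close> according to the label -1, 0 or 1.\<close>
  define t where "t i = s * exp (L * r i)" for i
  have t: "t i \<ge> a" for i
  proof -
    have "a = s * exp (- L)" using s a by (simp add: L_def exp_minus)
    also have "\<dots> \<le> s * exp (L * r i)" using s L r[rule_format, of i] by auto
    finally show ?thesis by (simp add: t_def)
  qed
  have m_nonneg: "hv_mean \<tau> a * real n \<ge> 0"
    using n zero_le_power2[of a] by linarith
  have integrand: "(\<Prod>e\<in>E. min ((\<Prod>i\<in>e. h (\<phi> i)) / (hv_mean \<tau> a * real n)) 1)
      = (\<Prod>e\<in>E. min (\<Prod>i\<in>e. h (\<phi> i) / s) 1)" for h
    unfolding s_def using m_nonneg
    by (intro prod.cong refl arg_cong2[of _ _ _ _ min] edge_weight_rescale[OF G]) auto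
  have prod_const: "(\<Prod>i\<in>V. ennreal x) = ennreal (x ^ card V)" if "x \<ge> 0" for x
    using that by (simp add: ennreal_power)
  have meas_component: "(\<lambda>h. f (h (\<phi> i))) \<in> borel_measurable ?P"
    if "i \<in> V" "f \<in> borel_measurable borel" for i and f :: "real \<Rightarrow> ennreal"
  proof -
    have "\<phi> i \<in> {..<n}" using \<phi> that by (auto simp: embeddings_def)
    then have "(\<lambda>h. h (\<phi> i)) \<in> measurable ?P ?M" by measurable
    moreover have "f \<in> borel_measurable ?M"
      using that by (simp cong: measurable_cong_sets add: sets_hv_dist)
    ultimately show ?thesis by (rule measurable_compose)
  qed
  have AE: "AE h in ?P. \<forall>i\<in>V. a \<le> h (\<phi> i)"
    using AE_PiM_hv_dist_ge[of a \<tau> n] a \<tau> \<phi> by (auto simp: embeddings_def elim!: eventually_mono)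

  let ?up = "\<lambda>i h. ennreal ((h / s) powr (\<tau> - 1) * exp (- c * \<bar>ln (h / t i)\<bar>))"
  have "J \<le> (\<integral>\<^sup>+h. ennreal ((s / a) powr b) * (\<Prod>i\<in>V. ?up i (h (\<phi> i))) \<partial>?P)"
    unfolding J_def
  proof (rule nn_integral_mono_AE)
    show "AE h in ?P. ennreal (\<Prod>e\<in>E. min ((\<Prod>i\<in>e. h (\<phi> i)) / (hv_mean \<tau> a * real n)) 1)
        \<le> ennreal ((s / a) powr b) * (\<Prod>i\<in>V. ?up i (h (\<phi> i)))"
      using AE
    proof eventually_elim
      case (elim h)
      define x where "x i = h (\<phi> i) / s" for i
      define u where "u i = ln (x i) / L" for i
      have x: "x i > 0" if "i \<in> V" for i using elim that a s by (force simp: x_def)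
      have u: "-1 \<le> u i" if "i \<in> V" for i
      proof -
        have "ln (a / s) \<le> ln (x i)" using elim that a s by (auto simp: x_def divide_right_mono)
        moreover have "ln (a / s) = - L" using a s by (simp add: L_def ln_div)
        ultimately show ?thesis using L by (simp add: u_def field_simps)
      qed
      \<comment> \<open>Distance from the optimal exponent, scaled by \<open>L\<close>, is the
        logarithmic distance of the hidden variable from its optimal scale.\<close>
      have dev: "L * \<bar>u i - r i\<bar> = \<bar>ln (h (\<phi> i) / t i)\<bar>" if "i \<in> V" for i
      proof -
        have "L * \<bar>u i - r i\<bar> = \<bar>L * (u i - r i)\<bar>" using L by (simp add: abs_mult)
        also have "L * (u i - r i) = ln (x i) - L * r i" using L by (simp add: u_def algebra_simps)
        also have "\<dots> = ln (x i / exp (L * r i))" using x[OF that] by (simp add: ln_div)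
        also have "x i / exp (L * r i) = h (\<phi> i) / t i" by (simp add: x_def t_def)
        finally show ?thesis .
      qed
      have "(\<Prod>e\<in>E. min (\<Prod>i\<in>e. x i) 1) = exp (L * log_weight \<tau> V E u) * (\<Prod>i\<in>V. x i powr (\<tau> - 1))"
        unfolding u_def using x L by (rule prod_min_edges_eq_exp[OF G])
      also have "\<dots> \<le> exp (L * (b - c * (\<Sum>i\<in>V. \<bar>u i - r i\<bar>))) * (\<Prod>i\<in>V. x i powr (\<tau> - 1))"
        using decay u L by (intro mult_right_mono prod_nonneg) auto
      also have "L * (b - c * (\<Sum>i\<in>V. \<bar>u i - r i\<bar>)) = L * b + (\<Sum>i\<in>V. - c * (L * \<bar>u i - r i\<bar>))"
        by (simp add: algebra_simps sum_negf sum_distrib_left)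
      also have "\<dots> = L * b + (\<Sum>i\<in>V. - c * \<bar>ln (h (\<phi> i) / t i)\<bar>)"
        using dev by simp
      also have "exp \<dots> = (s / a) powr b * (\<Prod>i\<in>V. exp (- c * \<bar>ln (h (\<phi> i) / t i)\<bar>))"
        using finV by (simp only: exp_add exp_sum exp_L)
      finally have "(\<Prod>e\<in>E. min (\<Prod>i\<in>e. x i) 1)
          \<le> (s / a) powr b * (\<Prod>i\<in>V. x i powr (\<tau> - 1) * exp (- c * \<bar>ln (h (\<phi> i) / t i)\<bar>))"
        by (simp add: prod.distrib mult_ac)
      then have "ennreal (\<Prod>e\<in>E. min (\<Prod>i\<in>e. x i) 1)
          \<le> ennreal ((s / a) powr b * (\<Prod>i\<in>V. x i powr (\<tau> - 1) * exp (- c * \<bar>ln (h (\<phi> i) / t i)\<bar>)))"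
        by (rule ennreal_leI)
      also have "\<dots> = ennreal ((s / a) powr b) * (\<Prod>i\<in>V. ?up i (h (\<phi> i)))"
        unfolding x_def by (subst prod_ennreal) (auto intro!: ennreal_mult prod_nonneg)
      finally show ?case unfolding integrand x_def .
    qed
  qed
  also have "\<dots> = ennreal ((s / a) powr b) * (\<integral>\<^sup>+h. (\<Prod>i\<in>V. ?up i (h (\<phi> i))) \<partial>?P)"
    by (intro nn_integral_cmult borel_measurable_prod_ennreal meas_component) auto
  also have "(\<integral>\<^sup>+h. (\<Prod>i\<in>V. ?up i (h (\<phi> i))) \<partial>?P) = (\<Prod>i\<in>V. \<integral>\<^sup>+x. ?up i x \<partial>?M)"
    by (rule nn_integral_PiM_prod_embedding[OF M finV \<phi>]) (simp cong: measurable_cong_sets add: sets_hv_dist)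
  also have "ennreal ((s / a) powr b) * \<dots>
      \<le> ennreal ((s / a) powr b) * (\<Prod>i\<in>V. ennreal (hv_const \<tau> a * s powr (1 - \<tau>) * (2 / c)))"
    using a \<tau> s t c by (intro mult_left_mono prod_mono_ennreal nn_integral_hv_dist_upper) auto
  also have "\<dots> = ennreal ((s / a) powr b * (hv_const \<tau> a * s powr (1 - \<tau>) * (2 / c)) ^ card V)"
    using C c by (subst prod_const) (auto simp: ennreal_mult)
  finally show "J \<le> ennreal ((s / a) powr b * (hv_const \<tau> a * s powr (1 - \<tau>) * (2 / c)) ^ card V)" .

  \<comment> \<open>The edge product increases with the hidden variables, so on the box it is at
    least its value at the corner \<open>t\<close>, where the exponents are exactly
    \<open>r\<close>.\<close>
  let ?low = "\<lambda>i h. ennreal ((t i / s) powr (\<tau> - 1)) * indicator {t i..2 * t i} h"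
  have "ennreal ((s / a) powr b * (hv_const \<tau> a * s powr (1 - \<tau>) * 2 powr (- \<tau>)) ^ card V)
      = ennreal ((s / a) powr b) * (\<Prod>i\<in>V. ennreal (hv_const \<tau> a * s powr (1 - \<tau>) * 2 powr (- \<tau>)))"
    using C by (subst prod_const) (auto simp: ennreal_mult)
  also have "\<dots> \<le> ennreal ((s / a) powr b) * (\<Prod>i\<in>V. \<integral>\<^sup>+x. ?low i x \<partial>?M)"
    using a \<tau> s t by (intro mult_left_mono prod_mono_ennreal nn_integral_hv_dist_lower) auto
  also have "(\<Prod>i\<in>V. \<integral>\<^sup>+x. ?low i x \<partial>?M) = (\<integral>\<^sup>+h. (\<Prod>i\<in>V. ?low i (h (\<phi> i))) \<partial>?P)"
    by (rule nn_integral_PiM_prod_embedding[OF M finV \<phi>, symmetric])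
       (simp cong: measurable_cong_sets add: sets_hv_dist)
  also have "ennreal ((s / a) powr b) * \<dots>
      = (\<integral>\<^sup>+h. ennreal ((s / a) powr b) * (\<Prod>i\<in>V. ?low i (h (\<phi> i))) \<partial>?P)"
    by (intro nn_integral_cmult[symmetric] borel_measurable_prod_ennreal meas_component) auto
  also have "\<dots> \<le> J"
    unfolding J_def
  proof (rule nn_integral_mono)
    fix h
    show "ennreal ((s / a) powr b) * (\<Prod>i\<in>V. ?low i (h (\<phi> i)))
        \<le> ennreal (\<Prod>e\<in>E. min ((\<Prod>i\<in>e. h (\<phi> i)) / (hv_mean \<tau> a * real n)) 1)"
    proof (cases "\<forall>i\<in>V. h (\<phi> i) \<in> {t i..2 * t i}")
      case True
      have t_pos: "t i / s > 0" for i using s by (simp add: t_def)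
      have "ennreal ((s / a) powr b) * (\<Prod>i\<in>V. ?low i (h (\<phi> i)))
          = ennreal ((s / a) powr b) * (\<Prod>i\<in>V. ennreal ((t i / s) powr (\<tau> - 1)))"
        using True by (simp cong: prod.cong)
      also have "\<dots> = ennreal ((s / a) powr b * (\<Prod>i\<in>V. (t i / s) powr (\<tau> - 1)))"
        by (subst prod_ennreal) (auto simp: ennreal_mult intro!: ennreal_mult[symmetric] prod_nonneg)
      also have "(s / a) powr b * (\<Prod>i\<in>V. (t i / s) powr (\<tau> - 1)) = (\<Prod>e\<in>E. min (\<Prod>i\<in>e. t i / s) 1)"
      proof -
        have "(\<lambda>i. ln (t i / s) / L) = r" using s L by (simp add: t_def)
        then show ?thesis
          using prod_min_edges_eq_exp[where \<tau> = \<tau>, OF G t_pos L] r_opt by (simp add: exp_L)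
      qed
      also have "ennreal \<dots> \<le> ennreal (\<Prod>e\<in>E. min (\<Prod>i\<in>e. h (\<phi> i) / s) 1)"
      proof (intro ennreal_leI prod_mono conjI)
        fix e assume "e \<in> E"
        then have "e \<subseteq> V" using G by (auto simp: simple_graph_def)
        then show "min (\<Prod>i\<in>e. t i / s) 1 \<le> min (\<Prod>i\<in>e. h (\<phi> i) / s) 1"
          using True t_pos s by (intro min.mono prod_mono) (auto intro!: divide_right_mono intro: less_imp_le)
        show "0 \<le> min (\<Prod>i\<in>e. t i / s) 1"
          by (simp add: prod_nonneg less_imp_le[OF t_pos])
      qed
      finally show ?thesis unfolding integrand .
    next
      case False
      then have "(\<Prod>i\<in>V. ?low i (h (\<phi> i))) = 0" using finV by (auto simp: prod_zero_iff indicator_def)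
      then show ?thesis by (simp only: mult_zero_right) simp
    qed
  qed
  finally show "ennreal ((s / a) powr b * (hv_const \<tau> a * s powr (1 - \<tau>) * 2 powr (- \<tau>)) ^ card V) \<le> J" .
qed

theorem theorem1:
  fixes \<tau> hmin :: real and V :: "'a set" and E :: "'a set set" and k :: nat
  assumes "2 < \<tau>" and "\<tau> < 3" and "hmin > 0"
    and "simple_graph V E" and "card V = k"
    and "\<exists>!P. P \<in> partitions3 V \<and> partition_value \<tau> E P = B\<^sub>f \<tau> V E"
  shows "(\<lambda>n. expected_motif_count \<tau> hmin V E n)
           \<in> \<Theta>(\<lambda>n. real n powr ((3 - \<tau>) / 2 * real k + (\<tau> - 1) / 2 * B\<^sub>f \<tau> V E))"
proof -
  note \<tau> = \<open>2 < \<tau>\<close> and a = \<open>hmin > 0\<close> and G = \<open>simple_graph V E\<close>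
  have finV: "finite V" using G by (simp add: simple_graph_def)
  let ?b = "(\<tau> - 1) * B\<^sub>f \<tau> V E" and ?\<mu> = "hv_mean \<tau> hmin" and ?C = "hv_const \<tau> hmin"
  let ?g = "\<lambda>n. real n powr ((3 - \<tau>) / 2 * real k + (\<tau> - 1) / 2 * B\<^sub>f \<tau> V E)"
  have "\<tau> > 1" using \<tau> by simp
  obtain c r where c: "c > 0" and r: "\<forall>i. r i \<in> {-1, 0, 1}" "log_weight \<tau> V E r = ?b"
    and decay: "\<forall>u. (\<forall>i\<in>V. -1 \<le> u i) \<longrightarrow>
       log_weight \<tau> V E u \<le> ?b - c * (\<Sum>i\<in>V. \<bar>u i - r i\<bar>)"
    using log_weight_decay[OF G \<open>\<tau> > 1\<close> assms(6)] by blast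
  have \<mu>: "?\<mu> > 0" using a \<tau> by (simp add: hv_mean_eq)
  have C: "?C > 0" using a \<tau> by (simp add: hv_const_eq)
  \<comment> \<open>The factor independent of \<open>n\<close> that remains after expanding the
    powers of \<open>s n / hmin\<close> and \<open>s n\<close>.\<close>
  define \<kappa> where "\<kappa> = ?\<mu> powr ((1 - \<tau>) / 2 * real k + ?b / 2) * hmin powr (- ?b)"
  have \<kappa>: "\<kappa> > 0" using \<mu> a by (simp add: \<kappa>_def)
  define s where "s n = sqrt (?\<mu> * real n)" for n
  \<comment> \<open>Both bounds share this form, with \<open>d = 2 / c\<close> above and
    \<open>d = 2 powr (- \<tau>)\<close> below. The exponent of \<open>n\<close> is \<open>k\<close>
    from the embeddings, \<open>(1 - \<tau>) / 2 * k\<close> from the vertex factors and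
    \<open>?b / 2\<close> from the optimum.\<close>
  have rate: "real n ^ k * ((s n / hmin) powr ?b * (?C * s n powr (1 - \<tau>) * d) ^ k) = (?C * d) ^ k * \<kappa> * ?g n"
    if n: "n > 0" for n d
  proof -
    have s: "s n = (?\<mu> * real n) powr (1 / 2)" using \<mu> n by (simp add: s_def powr_half_sqrt)
    have 1: "real n ^ k = real n powr real k" using n by (simp add: powr_realpow)
    have "(s n powr (1 - \<tau>)) ^ k = s n powr ((1 - \<tau>) * real k)"
      using \<mu> n by (simp add: s flip: powr_realpow add: powr_powr)
    also have "\<dots> = ?\<mu> powr ((1 - \<tau>) / 2 * real k) * real n powr ((1 - \<tau>) / 2 * real k)"
      using \<mu> n by (simp add: s powr_powr powr_mult)
    finally have 2: "(s n powr (1 - \<tau>)) ^ k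
      = ?\<mu> powr ((1 - \<tau>) / 2 * real k) * real n powr ((1 - \<tau>) / 2 * real k)" .
    have 3: "(s n / hmin) powr ?b = ?\<mu> powr (?b / 2) * real n powr (?b / 2) * hmin powr (- ?b)"
    proof -
      have "(s n / hmin) powr ?b = s n powr ?b * hmin powr (- ?b)"
        using \<mu> a by (subst powr_divide) (auto simp: s_def powr_minus divide_inverse)
      also have "s n powr ?b = (?\<mu> * real n) powr (?b / 2)"
        unfolding s powr_powr by (simp only: times_divide_eq_left mult_1)
      also have "\<dots> = ?\<mu> powr (?b / 2) * real n powr (?b / 2)"
        by (rule powr_mult)
      finally show ?thesis .
    qed
    have "(3 - \<tau>) / 2 * x + (\<tau> - 1) / 2 * y = x + (1 - \<tau>) / 2 * x + (\<tau> - 1) * y / 2" for x y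
      by (simp add: diff_divide_distrib left_diff_distrib)
    from this[of "real k" "B\<^sub>f \<tau> V E"] have "?g n = real n powr (real k + (1 - \<tau>) / 2 * real k + ?b / 2)"
      by (simp only:)
    also have "\<dots> = real n powr real k * real n powr ((1 - \<tau>) / 2 * real k) * real n powr (?b / 2)"
      by (simp only: powr_add)
    finally have 4: "?g n = \<dots>" .
    show ?thesis
      unfolding 4 unfolding power_mult_distrib 1 2 3 \<kappa>_def powr_add by (simp only: mult_ac)
  qed
  show ?thesis
  proof (rule bigthetaI')
    show "(1 / 2) ^ k * ((?C * 2 powr (- \<tau>)) ^ k * \<kappa>) > 0" and "(?C * (2 / c)) ^ k * \<kappa> > 0"
      using C \<kappa> c by auto
    have "filterlim (\<lambda>n. ?\<mu> * real n) at_top sequentially"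
      using \<mu> by (intro filterlim_tendsto_pos_mult_at_top[OF tendsto_const] filterlim_real_sequentially)
    then have "eventually (\<lambda>n. ?\<mu> * real n > hmin\<^sup>2) sequentially"
      by (simp add: filterlim_at_top_dense)
    then show "\<forall>\<^sub>F n in sequentially.
        (1 / 2) ^ k * ((?C * 2 powr (- \<tau>)) ^ k * \<kappa>) * norm (?g n) \<le> norm (expected_motif_count \<tau> hmin V E n)
        \<and> norm (expected_motif_count \<tau> hmin V E n) \<le> (?C * (2 / c)) ^ k * \<kappa> * norm (?g n)"
      using eventually_ge_at_top[of "2 * k"]
    proof eventually_elim
      case (elim n)
      \<comment> \<open>For \<open>n = 0\<close> the bound
        \<open>?\<mu> * real n > hmin\<^sup>2\<close> would fail.\<close>
      then have "n > 0" by (cases n) auto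
      note bounds = embedding_integral_bounds[OF G a \<tau> c r decay elim(1), folded s_def]
      define J where "J \<phi> = (\<integral>\<^sup>+h. ennreal (\<Prod>e\<in>E. min ((\<Prod>i\<in>e. h (\<phi> i)) / (?\<mu> * real n)) 1)
        \<partial>(\<Pi>\<^sub>M v\<in>{..<n}. hv_dist \<tau> hmin))" for \<phi>
      define l u where "l = (s n / hmin) powr ?b * (?C * s n powr (1 - \<tau>) * 2 powr (- \<tau>)) ^ k"
        and "u = (s n / hmin) powr ?b * (?C * s n powr (1 - \<tau>) * (2 / c)) ^ k"
      have lu: "l \<ge> 0" "u \<ge> 0" using C c by (auto simp: l_def u_def)
      have J: "ennreal l \<le> J \<phi>" "J \<phi> \<le> ennreal u" if "\<phi> \<in> embeddings V n" for \<phi>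
        using bounds[OF that] \<open>card V = k\<close> unfolding J_def l_def u_def by simp_all
      let ?N = "real (card (embeddings V n))"
      have EN: "expected_motif_count \<tau> hmin V E n = enn2real (\<Sum>\<phi>\<in>embeddings V n. J \<phi>)"
        unfolding J_def by (rule expected_motif_count_eq[OF G a \<tau>])
      have "(\<Sum>\<phi>\<in>embeddings V n. J \<phi>) \<le> (\<Sum>\<phi>\<in>embeddings V n. ennreal u)"
        using J by (intro sum_mono) auto
      also have "\<dots> = ennreal (?N * u)"
        using lu by (simp add: ennreal_mult ennreal_of_nat_eq_real_of_nat)
      finally have up: "(\<Sum>\<phi>\<in>embeddings V n. J \<phi>) \<le> ennreal (?N * u)" .
      have "ennreal (?N * l) = (\<Sum>\<phi>\<in>embeddings V n. ennreal l)"
        using lu by (simp add: ennreal_mult ennreal_of_nat_eq_real_of_nat)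
      also have "\<dots> \<le> (\<Sum>\<phi>\<in>embeddings V n. J \<phi>)"
        using J by (intro sum_mono) auto
      finally have low: "ennreal (?N * l) \<le> (\<Sum>\<phi>\<in>embeddings V n. J \<phi>)" .
      have "(1 / 2) ^ k * ((?C * 2 powr (- \<tau>)) ^ k * \<kappa>) * ?g n = (1 / 2) ^ k * (real n ^ k * l)"
        unfolding l_def rate[OF \<open>n > 0\<close>] by simp
      also have "\<dots> = (real n / 2) ^ k * l"
        by (simp add: power_divide)
      also have "\<dots> \<le> ?N * l"
        using lu card_embeddings_ge[OF finV, of n] elim \<open>card V = k\<close> by (intro mult_right_mono) auto
      also have "\<dots> = enn2real (ennreal (?N * l))" using lu by simp
      \<comment> \<open>Monotonicity of \<open>enn2real\<close> requires a finite right-hand side,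
        which \<open>up\<close> supplies.\<close>
      also have "\<dots> \<le> expected_motif_count \<tau> hmin V E n"
        unfolding EN using low up by (intro enn2real_mono) (auto intro: le_less_trans)
      finally have 1: "(1 / 2) ^ k * ((?C * 2 powr (- \<tau>)) ^ k * \<kappa>) * ?g n \<le> expected_motif_count \<tau> hmin V E n" .
      have "expected_motif_count \<tau> hmin V E n \<le> ?N * u"
        unfolding EN using up lu by (intro enn2real_leI) auto
      also have "\<dots> \<le> real n ^ k * u"
        using lu card_embeddings_le[OF finV, of n] \<open>card V = k\<close> by (intro mult_right_mono) auto
      also have "\<dots> = (?C * (2 / c)) ^ k * \<kappa> * ?g n"
        unfolding u_def by (rule rate[OF \<open>n > 0\<close>])
      finally show ?case using 1 by (simp add: EN)
    qed
  qed
qed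

end
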